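(* Let $X$ and $Y$ be Banach spaces over $\mathbb{K}\in\{\mathbb{R},\mathbb{C}\}$, $\Gamma$ an arbitrary set, $E$ an invariant sequence space over $X$, and for each $\lambda\in\Gamma$ let $F_\lambda$ be a strongly invariant sequence space over $\mathbb{K}$. Suppose $f\colon X\to Y$ is strongly compatible with $F_\lambda^w(Y)$ for every $\lambda\in\Gamma$, and that the family $(F_\lambda^w(Y))_{\lambda\in\Gamma}$ is nested. Then the set $$G^w\big(E,f,(F_\lambda)_{\lambda\in\Gamma}\big)=\Big\{(x_j)_{j=1}^\infty\in E:\ (f(x_j))_{j=1}^\infty\notin\bigcup_{\lambda\in\Gamma}F^w_\lambda(Y)\Big\}$$ is either empty or pointwise $\mathfrak{c}$-spaceable in $E$; i.e., if it is nonempty, then for every $x$ in it there is a closed linear subspace $W_x$ of $E$ with $\dim W_x=\mathfrak{c}$ and $x\in W_x\subset G^w(E,f,(F_\lambda)_{\lambda\in\Gamma})\cup\{0\}$.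
   Context: $\mathfrak{c}=\operatorname{card}(\mathbb{R})$; $Y'$ denotes the topological dual of $Y$. Zero-free version: for $x=(x_j)_{j=1}^\infty\in Z^{\mathbb{N}}$ ($Z$ a Banach space), if $x$ has only finitely many nonzero coordinates then $x^0=0$; otherwise $x^0=(x_{j_k})_{k=1}^\infty$ where $x_{j_k}$ is the $k$-th nonzero coordinate of $x$. An invariant sequence space over a Banach space $Z\neq\{0\}$ is an infinite-dimensional Banach or quasi-Banach space $E$ which is a linear subspace of $Z^{\mathbb{N}}$ (coordinatewise operations) such that: (b1) there is a constant $K$ depending only on $E$ such that for all $x\in Z^{\mathbb{N}}$ with $x^0\neq0$, $x\in E\iff x^0\in E$, and $\|x\|_E\le K\|x^0\|_E$; (b2) $\|x_j\|_Z\le\|x\|_E$ for all $x=(x_j)\in E$ and all $j$. A strongly invariant sequence space over $Z$ is an invariant sequence space $E$ over $Z$ such that $c_{00}(Z)=\{(x_j)\in Z^{\mathbb{N}}: x_j=0\text{ for all but finitely many }j\}\subset E$, and $(x_j)_{j=1}^\infty\in E$ if and only if every subsequence of $(x_j)_{j=1}^\infty$ belongs to $E$. For an invariant sequence space $F$ over $\mathbb{K}$, $F^w(Y)=\{(y_j)_{j=1}^\infty\in Y^{\mathbb{N}}: (\varphi(y_j))_{j=1}^\infty\in F\text{ for all }\varphi\in Y'\}$. If $F$ is an invariant sequence space over $\mathbb{K}$, a function $g\colon X\to\mathbb{K}$ with $g(0)=0$ is compatible with $F$ if for every $X$-valued sequence $(x_j)$ and every scalar $a\neq0$: $(g(x_j))_j\notin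 F\Rightarrow(g(ax_j))_j\notin F$. A map $f\colon X\to Y$ with $f(0)=0$ is strongly compatible with $F^w(Y)$ if $\varphi\circ f$ is compatible with $F$ for every $\varphi\in Y'$. A family $(A_\lambda)_{\lambda\in\Gamma}$ of sets is nested if for all $\lambda_1,\lambda_2\in\Gamma$, either $A_{\lambda_1}\subset A_{\lambda_2}$ or $A_{\lambda_2}\subset A_{\lambda_1}$. *)

theory Defs
  imports "HOL-Analysis.Analysis" "HOL-Library.Equipollence" "HOL-Library.Infinite_Set" "HOL-Library.Function_Algebras"
begin

(* Scalar field K: a type 'k of class {real_normed_field, banach}; by Mazur's theorem
   (Gelfand--Mazur) such a field is (isometrically) R or C. *)

definition kbanach :: "('k::{real_normed_field,banach} \<Rightarrow> 'z::banach \<Rightarrow> 'z) \<Rightarrow> bool" where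
  "kbanach smul \<longleftrightarrow>
     (\<forall>a x y. smul a (x + y) = smul a x + smul a y) \<and>
     (\<forall>a b x. smul (a + b) x = smul a x + smul b x) \<and>
     (\<forall>a b x. smul a (smul b x) = smul (a * b) x) \<and>
     (\<forall>x. smul 1 x = x) \<and>
     (\<forall>r x. smul (of_real r) x = scaleR r x) \<and>
     (\<forall>a x. norm (smul a x) = norm a * norm x)"

definition kdual :: "('k::{real_normed_field,banach} \<Rightarrow> 'y::banach \<Rightarrow> 'y) \<Rightarrow> ('y \<Rightarrow> 'k) set" where
  "kdual smul = {\<phi>. bounded_linear \<phi> \<and> (\<forall>a y. \<phi> (smul a y) = a * \<phi> y)}"

definition seqscale :: "('k \<Rightarrow> 'z \<Rightarrow> 'z) \<Rightarrow> 'k \<Rightarrow> (nat \<Rightarrow> 'z) \<Rightarrow> (nat \<Rightarrow> 'z)" where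
  "seqscale smul a x = (\<lambda>j. smul a (x j))"

definition zero_free :: "(nat \<Rightarrow> 'z::zero) \<Rightarrow> (nat \<Rightarrow> 'z)" where
  "zero_free x = (if finite {j. x j \<noteq> 0} then (\<lambda>_. 0)
                  else (\<lambda>k. x (enumerate {j. x j \<noteq> 0} k)))"

definition lin_subspace :: "('k \<Rightarrow> 'z \<Rightarrow> 'z) \<Rightarrow> (nat \<Rightarrow> 'z::real_vector) set \<Rightarrow> bool" where
  "lin_subspace smul W \<longleftrightarrow> 0 \<in> W \<and> (\<forall>x\<in>W. \<forall>y\<in>W. x + y \<in> W)
      \<and> (\<forall>a. \<forall>x\<in>W. seqscale smul a x \<in> W)"

definition quasi_banach_seq :: "('k::{real_normed_field,banach} \<Rightarrow> 'z \<Rightarrow> 'z) \<Rightarrow> (nat \<Rightarrow> 'z::real_normed_vector) set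
      \<Rightarrow> ((nat \<Rightarrow> 'z) \<Rightarrow> real) \<Rightarrow> bool" where
  "quasi_banach_seq smul E N \<longleftrightarrow>
     lin_subspace smul E \<and>
     (\<forall>x\<in>E. N x \<ge> 0 \<and> (N x = 0 \<longleftrightarrow> x = 0)) \<and>
     (\<forall>a. \<forall>x\<in>E. N (seqscale smul a x) = norm a * N x) \<and>
     (\<exists>C\<ge>1. \<forall>x\<in>E. \<forall>y\<in>E. N (x + y) \<le> C * (N x + N y)) \<and>
     (\<forall>s. (\<forall>n. s n \<in> E) \<and> (\<forall>\<epsilon>>0. \<exists>M. \<forall>m\<ge>M. \<forall>n\<ge>M. N (s m - s n) < \<epsilon>)
          \<longrightarrow> (\<exists>x\<in>E. (\<lambda>n. N (s n - x)) \<longlonglongrightarrow> 0))"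

definition infinite_dim :: "('k::{real_normed_field,banach} \<Rightarrow> 'z \<Rightarrow> 'z) \<Rightarrow> (nat \<Rightarrow> 'z::real_vector) set \<Rightarrow> bool" where
  "infinite_dim smul E \<longleftrightarrow> \<not> (\<exists>S. finite S \<and> S \<subseteq> E \<and> module.span (seqscale smul) S = E)"

definition inv_seq_space :: "('k::{real_normed_field,banach} \<Rightarrow> 'z \<Rightarrow> 'z) \<Rightarrow> (nat \<Rightarrow> 'z::banach) set
      \<Rightarrow> ((nat \<Rightarrow> 'z) \<Rightarrow> real) \<Rightarrow> bool" where
  "inv_seq_space smul E N \<longleftrightarrow>
     kbanach smul \<and> (\<exists>z::'z. z \<noteq> 0) \<and>
     quasi_banach_seq smul E N \<and> infinite_dim smul E \<and>
     (\<exists>K::real. \<forall>x. zero_free x \<noteq> 0 \<longrightarrow>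
         (x \<in> E \<longleftrightarrow> zero_free x \<in> E) \<and> (x \<in> E \<longrightarrow> N x \<le> K * N (zero_free x))) \<and>
     (\<forall>x\<in>E. \<forall>j. norm (x j) \<le> N x)"

definition c00 :: "(nat \<Rightarrow> 'z::zero) set" where
  "c00 = {x. finite {j. x j \<noteq> 0}}"

definition strongly_inv_seq_space :: "('k::{real_normed_field,banach} \<Rightarrow> 'z \<Rightarrow> 'z) \<Rightarrow> (nat \<Rightarrow> 'z::banach) set
      \<Rightarrow> ((nat \<Rightarrow> 'z) \<Rightarrow> real) \<Rightarrow> bool" where
  "strongly_inv_seq_space smul E N \<longleftrightarrow>
     inv_seq_space smul E N \<and> c00 \<subseteq> E \<and>
     (\<forall>x. x \<in> E \<longleftrightarrow> (\<forall>\<sigma>::nat\<Rightarrow>nat. strict_mono \<sigma> \<longrightarrow> x \<circ> \<sigma> \<in> E))"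

definition weak_seq :: "('k::{real_normed_field,banach} \<Rightarrow> 'y::banach \<Rightarrow> 'y) \<Rightarrow> (nat \<Rightarrow> 'k) set \<Rightarrow> (nat \<Rightarrow> 'y) set" where
  "weak_seq smulY F = {y. \<forall>\<phi>\<in>kdual smulY. (\<lambda>j. \<phi> (y j)) \<in> F}"

definition compatible :: "('k::{real_normed_field,banach} \<Rightarrow> 'x \<Rightarrow> 'x) \<Rightarrow> ('x::zero \<Rightarrow> 'k) \<Rightarrow> (nat \<Rightarrow> 'k) set \<Rightarrow> bool" where
  "compatible smulX g F \<longleftrightarrow> g 0 = 0 \<and>
     (\<forall>(x::nat \<Rightarrow> 'x) (a::'k). a \<noteq> 0 \<longrightarrow> (\<lambda>j. g (x j)) \<notin> F \<longrightarrow> (\<lambda>j. g (smulX a (x j))) \<notin> F)"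

definition strongly_compatible :: "('k::{real_normed_field,banach} \<Rightarrow> 'x \<Rightarrow> 'x) \<Rightarrow> ('k \<Rightarrow> 'y \<Rightarrow> 'y)
      \<Rightarrow> ('x::zero \<Rightarrow> 'y::banach) \<Rightarrow> (nat \<Rightarrow> 'k) set \<Rightarrow> bool" where
  "strongly_compatible smulX smulY f F \<longleftrightarrow> f 0 = 0 \<and> (\<forall>\<phi>\<in>kdual smulY. compatible smulX (\<phi> \<circ> f) F)"

definition nested :: "'i set \<Rightarrow> ('i \<Rightarrow> 'a set) \<Rightarrow> bool" where
  "nested \<Gamma> A \<longleftrightarrow> (\<forall>l1\<in>\<Gamma>. \<forall>l2\<in>\<Gamma>. A l1 \<subseteq> A l2 \<or> A l2 \<subseteq> A l1)"

(* W is closed in E with respect to the (quasi-)norm N (sequential closedness; the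
   quasi-norm topology is metrizable) *)
definition seq_closed_in :: "(nat \<Rightarrow> 'z) set \<Rightarrow> ((nat \<Rightarrow> 'z::real_vector) \<Rightarrow> real) \<Rightarrow> (nat \<Rightarrow> 'z) set \<Rightarrow> bool" where
  "seq_closed_in E N W \<longleftrightarrow> (\<forall>s x. (\<forall>n. s n \<in> W) \<and> x \<in> E \<and> (\<lambda>n. N (s n - x)) \<longlonglongrightarrow> 0 \<longrightarrow> x \<in> W)"

definition dim_continuum :: "('k::{real_normed_field,banach} \<Rightarrow> 'z \<Rightarrow> 'z) \<Rightarrow> (nat \<Rightarrow> 'z::real_vector) set \<Rightarrow> bool" where
  "dim_continuum smul W \<longleftrightarrow> (\<exists>B. B \<subseteq> W \<and> \<not> module.dependent (seqscale smul) B
      \<and> module.span (seqscale smul) B = W \<and> B \<approx> (UNIV :: real set))"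

definition Gw :: "('k::{real_normed_field,banach} \<Rightarrow> 'y \<Rightarrow> 'y) \<Rightarrow> (nat \<Rightarrow> 'x) set \<Rightarrow> ('x \<Rightarrow> 'y::banach)
      \<Rightarrow> 'i set \<Rightarrow> ('i \<Rightarrow> (nat \<Rightarrow> 'k) set) \<Rightarrow> (nat \<Rightarrow> 'x) set" where
  "Gw smulY E f \<Gamma> F = {x \<in> E. (\<lambda>j. f (x j)) \<notin> (\<Union>l\<in>\<Gamma>. weak_seq smulY (F l))}"

end

(* Let x lie in the set. Its support splits into two infinite pieces, and since the
   family of weak spaces is nested their union is closed under addition, so the
   restriction of x to one of the pieces, B, still escapes the union. Divide the other piece C into
   infinitely many infinite blocks and place a copy of the zero-free version of x along each.
   Let W be the closed span of x and these copies. Coordinates are continuous, so every w in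
   W equals a x off C and a x plus a multiple of a copy on each block. If a is nonzero, then w escapes
   the union along B; otherwise w escapes it along any block with a nonzero coefficient.

   The dimension of W is at most the continuum because every element of W is the limit of a sequence
   of finite combinations of countably many vectors, and the scalars are at most quadratic over the
   reals (Gelfand-Mazur). It is at least the
   continuum in any infinite-dimensional quasi-Banach space: take independent vectors e_n
   decreasing rapidly compared with the distance of each from the span of its predecessors, and sum
   them over an almost disjoint family of continuum many subsets of the naturals. This
   dimension argument also settles the case of an empty index set, where the set is all of E. *)

theory Submission
  imports Defs "HOL-Computational_Algebra.Fundamental_Theorem_Algebra"
begin

section \<open>Real normed fields\<close>

lemma map_poly_of_real_mult:
  "map_poly (of_real :: real \<Rightarrow> 'a::{real_algebra_1,comm_ring_1}) (p * q) = map_poly of_real p * map_poly of_real q"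
  by (intro poly_eqI) (simp add: coeff_map_poly coeff_mult)

lemma map_poly_of_real_add:
  "map_poly (of_real :: real \<Rightarrow> 'a::{real_algebra_1,comm_ring_1}) (p + q) = map_poly of_real p + map_poly of_real q"
  by (intro poly_eqI) (simp add: coeff_map_poly)

lemma complex_root_of_real_poly:
  fixes q :: "real poly"
  assumes "degree q \<ge> 1"
  shows "\<exists>z. poly (map_poly complex_of_real q) z = 0"
proof -
  have "degree (map_poly complex_of_real q) = degree q" by (simp add: degree_map_poly)
  then have "\<not> constant (poly (map_poly complex_of_real q))"
    using assms constant_degree[of "map_poly complex_of_real q"] by auto
  then show ?thesis using fundamental_theorem_of_algebra by blast
qed

text \<open>The factor is (X - z)(X - conj z), which has real coefficients. The remainder modulo it
  is real of degree at most 1 and vanishes at the nonreal \<open>z\<close>, hence is zero.\<close>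

lemma nonreal_root_quadratic_factor:
  fixes q :: "real poly"
  assumes z: "poly (map_poly complex_of_real q) z = 0" "Im z \<noteq> 0"
  shows "\<exists>b c. [:c, b, 1:] dvd q"
proof -
  let ?d = "[:(Re z)\<^sup>2 + (Im z)\<^sup>2, - 2 * Re z, 1:]"
  let ?C = "map_poly complex_of_real"
  define r where "r = q mod ?d"
  have d0: "poly (?C ?d) z = 0"
    by (simp add: map_poly_pCons complex_eq_iff power2_eq_square algebra_simps)
  have "q = ?d * (q div ?d) + r" unfolding r_def by (metis mult_div_mod_eq)
  then have "?C q = ?C ?d * ?C (q div ?d) + ?C r"
    by (metis map_poly_of_real_add map_poly_of_real_mult)
  with z d0 have rz: "poly (?C r) z = 0" by simp
  have "r = 0 \<or> degree r < degree ?d"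
    unfolding r_def by (rule degree_mod_less) simp
  then have deg: "degree r \<le> 1" by auto
  obtain u v where uv: "r = pCons u v" by (cases r)
  with deg have "degree v = 0" by (cases "v = 0") auto
  then obtain w where r: "r = [:u, w:]" using uv degree_eq_zeroE by metis
  have "complex_of_real u + z * complex_of_real w = 0"
    using rz by (simp add: r map_poly_pCons)
  then have "r = 0" using z(2) by (auto simp: r complex_eq_iff)
  then have "?d dvd q" unfolding r_def by (simp only: mod_eq_0_iff_dvd)
  then show ?thesis by blast
qed

text \<open>A nonreal root yields a quadratic factor at once. If only a linear factor splits off,
  the quotient still has degree at least 1 and gives either a quadratic factor or a second linear
  one, and two linear factors multiply to a monic quadratic.\<close>

lemma real_poly_monic_quadratic_factor:
  fixes p :: "real poly"
  assumes "degree p \<ge> 2"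
  shows "\<exists>b c. [:c, b, 1:] dvd p"
proof -
  have lin: "(\<exists>b c. [:c, b, 1:] dvd q) \<or> (\<exists>t. [:-t, 1:] dvd q)" if deg: "degree q \<ge> 1" for q :: "real poly"
  proof -
    obtain z where z: "poly (map_poly complex_of_real q) z = 0"
      using complex_root_of_real_poly[OF deg] by blast
    show ?thesis
    proof (cases "Im z = 0")
      case True
      then have "z = complex_of_real (Re z)" by (simp add: complex_eq_iff)
      moreover have "poly (map_poly complex_of_real q) (complex_of_real t) = complex_of_real (poly q t)" for t
        by (induction q) (simp_all add: map_poly_pCons)
      ultimately have "poly q (Re z) = 0" using z by (metis of_real_eq_0_iff)
      then show ?thesis by (auto simp: poly_eq_0_iff_dvd)
    qed (use nonreal_root_quadratic_factor z in blast)
  qed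
  from lin[of p] assms consider "\<exists>b c. [:c, b, 1:] dvd p" | t where "[:-t, 1:] dvd p" by fastforce
  then show ?thesis
  proof cases
    case 2
    then obtain q where q: "p = [:-t, 1:] * q" by blast
    then have "q \<noteq> 0" using assms by auto
    then have "degree p = 1 + degree q" unfolding q by (subst degree_mult_eq) auto
    with lin[of q] assms consider b c where "[:c, b, 1:] dvd q" | s where "[:-s, 1:] dvd q" by fastforce
    then show ?thesis
    proof cases
      case 1 then show ?thesis unfolding q by (meson dvd_mult)
    next
      case 2
      then have "[:-t, 1:] * [:-s, 1:] dvd p" unfolding q by (rule mult_dvd_mono[OF dvd_refl])
      then show ?thesis by auto
    qed
  qed
qed

text \<open>The polynomial is a product of \<open>n\<close> monic real quadratics, and the norm of a
  real normed field is multiplicative, so the bound for one quadratic is raised to the power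
  \<open>n\<close>.\<close>

lemma norm_monic_poly_ge:
  fixes x :: "'k::real_normed_field"
  assumes m: "m \<ge> 0" "\<And>b c. m \<le> norm (poly (map_poly of_real [:c, b, 1:]) x)"
    and "lead_coeff p = 1" "degree p = 2 * n"
  shows "m ^ n \<le> norm (poly (map_poly of_real p) x)"
  using assms(3,4)
proof (induction n arbitrary: p)
  case 0
  then have "p = 1" by (metis degree_eq_zeroE lead_coeff_pCons(2) mult_0_right one_pCons)
  then show ?case by simp
next
  case (Suc n)
  obtain b c where "[:c, b, 1:] dvd p"
    using real_poly_monic_quadratic_factor[of p] Suc.prems by auto
  then obtain q where q: "p = [:c, b, 1:] * q" by blast
  then have q0: "q \<noteq> 0" using Suc.prems by auto
  have "degree p = 2 + degree q" unfolding q using q0 by (subst degree_mult_eq) auto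
  moreover have "lead_coeff q = 1" using Suc.prems(1) unfolding q lead_coeff_mult by simp
  ultimately have "m ^ n \<le> norm (poly (map_poly of_real q) x)"
    using Suc.IH Suc.prems by simp
  then have "m * m ^ n \<le> norm (poly (map_poly of_real [:c, b, 1:]) x) * norm (poly (map_poly of_real q) x)"
    using m by (intro mult_mono) auto
  then show ?case unfolding q map_poly_of_real_mult by (simp only: poly_mult norm_mult power_Suc)
qed

section \<open>Elements of a real normed field are quadratic over the reals\<close>

text \<open>If the minimum \<open>m\<close> were positive, the norm would remain equal to
  \<open>m\<close> when the constant coefficient is shifted by less than \<open>m\<close>. Repeating
  the shift keeps the norm at \<open>m\<close> arbitrarily far out, which is absurd.\<close>

lemma real_quadratic_root_of_attained_min:
  fixes x :: "'k::real_normed_field"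
  assumes min: "\<And>b c :: real. norm (x\<^sup>2 + of_real b0 * x + of_real c0) \<le> norm (x\<^sup>2 + of_real b * x + of_real c)"
  shows "x\<^sup>2 + of_real b0 * x + of_real c0 = 0"
proof (rule ccontr)
  define P where "P = (\<lambda>c. x\<^sup>2 + of_real b0 * x + of_real c)"
  define m where "m = norm (P c0)"
  assume "\<not> ?thesis"
  then have m0: "m > 0" by (simp add: m_def P_def)
  have ev: "poly (map_poly of_real [:c, b, 1:]) x = x\<^sup>2 + of_real b * x + of_real c" for b c :: real
    by (simp add: map_poly_pCons power2_eq_square algebra_simps)
  have mle: "m \<le> norm (poly (map_poly of_real [:c, b, 1:]) x)" for b c
    unfolding ev m_def P_def by (rule min)
  \<comment> \<open>\<open>P (c + h)\<close> is a factor of \<open>P c ^ Suc n - (- h) ^ Suc n\<close>, and the cofactor, a monic polynomial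
    of degree \<open>2 * n\<close> in \<open>x\<close>, has norm at least \<open>m ^ n\<close>.\<close>
  have step: "norm (P (c + h)) = m" if c: "norm (P c) = m" and h: "\<bar>h\<bar> < m" for c h :: real
  proof -
    have bound: "norm (P (c + h)) \<le> m + m * (\<bar>h\<bar> / m) ^ Suc n" for n
    proof -
      let ?U = "[:c, b0, 1:]" and ?V = "[:c + h, b0, 1:]"
      let ?G = "?U ^ Suc n - [:(-h) ^ Suc n:]"
      have "?U - [:-h:] dvd ?U ^ Suc n - [:-h:] ^ Suc n"
        by (metis dvd_triv_left power_diff_sumr2)
      moreover have "[:-h:] ^ k = [:(-h) ^ k:]" for k by (induction k) (simp_all add: one_pCons)
      moreover have "?U - [:-h:] = ?V" by simp
      ultimately have "?V dvd ?G" by metis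
      then obtain Q where Q: "?G = ?V * Q" by blast
      have degU: "degree (?U ^ Suc n) = 2 * Suc n" by (subst degree_power_eq) auto
      moreover have lt: "degree [:- ((-h) ^ Suc n):] < degree (?U ^ Suc n)" using degU by simp
      moreover have G: "?G = [:- ((-h) ^ Suc n):] + ?U ^ Suc n" by simp
      ultimately have deg: "degree ?G = 2 * Suc n" by (metis degree_add_eq_right)
      have "lead_coeff ?G = lead_coeff (?U ^ Suc n)" unfolding G using lt by (rule lead_coeff_add_le)
      also have "\<dots> = 1" unfolding lead_coeff_power by simp
      finally have lc: "lead_coeff ?G = 1" .
      have "Q \<noteq> 0" using lc unfolding Q by auto
      then have "degree ?G = 2 + degree Q" unfolding Q by (subst degree_mult_eq) auto
      then have "degree Q = 2 * n" using deg by simp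
      moreover have "lead_coeff Q = 1" using lc unfolding Q lead_coeff_mult by simp
      ultimately have "m ^ n \<le> norm (poly (map_poly of_real Q) x)"
        using norm_monic_poly_ge[of m x Q n] mle m0 by simp
      then have "norm (P (c + h)) * m ^ n \<le> norm (P (c + h)) * norm (poly (map_poly of_real Q) x)"
        by (intro mult_left_mono) auto
      also have "\<dots> = norm (poly (map_poly of_real ?G) x)"
        unfolding Q map_poly_of_real_mult by (simp only: poly_mult norm_mult ev P_def)
      also have "poly (map_poly of_real ?G) x = P c ^ Suc n - of_real ((-h) ^ Suc n)"
      proof -
        have pw: "poly (map_poly of_real (p ^ k)) x = poly (map_poly of_real p) x ^ k" for p k
          by (induction k) (simp_all add: map_poly_of_real_mult)
        have "poly (map_poly of_real (g + [:e:])) x = poly (map_poly of_real g) x + of_real e" for g e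
          by (simp add: map_poly_of_real_add map_poly_pCons)
        from this[of ?G "(-h) ^ Suc n"]
        have "poly (map_poly of_real (?U ^ Suc n)) x = poly (map_poly of_real ?G) x + of_real ((-h) ^ Suc n)"
          unfolding diff_add_cancel .
        then show ?thesis unfolding pw ev P_def by (simp only: add_diff_cancel_right')
      qed
      also have "norm \<dots> \<le> norm (P c ^ Suc n) + norm (of_real ((-h) ^ Suc n) :: 'k)"
        by (rule norm_triangle_ineq4)
      also have "\<dots> = m ^ Suc n + \<bar>h\<bar> ^ Suc n"
        by (simp only: norm_power c norm_of_real power_abs abs_minus_cancel)
      finally have "norm (P (c + h)) * m ^ n \<le> m ^ Suc n + \<bar>h\<bar> ^ Suc n" .
      then have "norm (P (c + h)) \<le> (m ^ Suc n + \<bar>h\<bar> ^ Suc n) / m ^ n"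
        using m0 by (simp add: field_simps)
      also have "\<dots> = m + m * (\<bar>h\<bar> / m) ^ Suc n"
        using m0 by (simp add: field_simps)
      finally show ?thesis .
    qed
    \<comment> \<open>Since the shift is smaller than \<open>m\<close>, the error term vanishes as
      \<open>n\<close> grows; minimality gives the opposite inequality.\<close>
    have "(\<lambda>n. (\<bar>h\<bar> / m) ^ Suc n) \<longlonglongrightarrow> 0"
      using m0 h by (intro LIMSEQ_Suc LIMSEQ_power_zero) simp
    then have "(\<lambda>n. m + m * (\<bar>h\<bar> / m) ^ Suc n) \<longlonglongrightarrow> m + m * 0"
      by (intro tendsto_intros)
    then have "norm (P (c + h)) \<le> m + m * 0"
      by (rule LIMSEQ_le_const) (use bound in blast)
    moreover have "m \<le> norm (P (c + h))" unfolding m_def P_def by (rule min)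
    ultimately show ?thesis by simp
  qed
  have far: "norm (P (c0 + real n * (m / 2))) = m" for n
  proof (induction n)
    case (Suc n)
    have eq: "c0 + real (Suc n) * (m / 2) = (c0 + real n * (m / 2)) + m / 2"
      by (simp add: field_simps)
    show ?case unfolding eq using m0 by (intro step Suc.IH) simp
  qed (simp add: m_def)
  \<comment> \<open>Two values of norm \<open>m\<close> differ by at most 2m, whereas five shifts by
    m/2 change the constant coefficient by 5m/2.\<close>
  have "(of_real (5 * (m / 2)) :: 'k) = P (c0 + real 5 * (m / 2)) - P c0" by (simp add: P_def)
  then have "norm (of_real (5 * (m / 2)) :: 'k) \<le> norm (P (c0 + real 5 * (m / 2))) + norm (P c0)"
    by (simp only: norm_triangle_ineq4)
  also have "\<dots> = m + m" using far[of 5] by (simp only: m_def)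
  finally show False using m0 by (simp only: norm_of_real)
qed

lemma continuous_attains_inf_bounded_sublevel:
  fixes g :: "'a::heine_borel \<Rightarrow> real"
  assumes cont: "continuous_on UNIV g" and bdd: "bounded {y. g y \<le> g a}"
  shows "\<exists>y. \<forall>z. g y \<le> g z"
proof -
  have "closed {y. g y \<le> g a}" using cont by (intro closed_Collect_le) auto
  then have "compact {y. g y \<le> g a}" using bdd by (simp add: compact_eq_bounded_closed)
  moreover have "{y. g y \<le> g a} \<noteq> {}" by auto
  ultimately obtain y where "g y \<le> g a" "\<And>z. g z \<le> g a \<Longrightarrow> g y \<le> g z"
    using continuous_attains_inf[of "{y. g y \<le> g a}" g] continuous_on_subset[OF cont] by auto
  then show ?thesis by (meson linear order_trans)
qed

text \<open>Gelfand--Mazur for fields, in the form that every element is at most quadratic over the reals.\<close>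
theorem real_normed_field_quadratic:
  fixes x :: "'k::real_normed_field"
  shows "\<exists>b c :: real. x\<^sup>2 + of_real b * x + of_real c = 0"
proof (cases "x \<in> \<real>")
  case True
  then obtain r where "x = of_real r" by (auto elim: Reals_cases)
  then have "x\<^sup>2 + of_real (- r) * x + of_real 0 = 0" by (simp add: power2_eq_square)
  then show ?thesis by blast
next
  case False
  \<comment> \<open>The distance from \<open>x\<close> to the reals is attained, hence positive
    because \<open>x\<close> is not real. It will control the coefficient \<open>b\<close> in the
    two-parameter minimization.\<close>
  have "\<exists>r::real. \<forall>s. norm (x - of_real r) \<le> norm (x - of_real s)"
  proof (rule continuous_attains_inf_bounded_sublevel[of "\<lambda>s. norm (x - of_real s)" 0])
    show "continuous_on UNIV (\<lambda>s. norm (x - of_real s))" by (intro continuous_intros)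
    have "\<bar>s\<bar> \<le> 2 * norm x" if "norm (x - of_real s) \<le> norm x" for s
    proof -
      have "norm (of_real s :: 'k) \<le> norm x + norm (x - of_real s)"
        by (metis add_diff_cancel_left' diff_add_cancel norm_minus_commute norm_triangle_sub)
      then show ?thesis using that by simp
    qed
    then show "bounded {s. norm (x - of_real s) \<le> norm (x - of_real 0)}"
      by (auto simp: bounded_iff)
  qed
  then obtain r where r: "\<And>s::real. norm (x - of_real r) \<le> norm (x - of_real s)" by blast
  define d where "d = norm (x - of_real r)"
  have d0: "d > 0" using False by (auto simp: d_def)
  \<comment> \<open>Factoring out \<open>b\<close> leaves \<open>x\<close> minus a real number,
    whose norm is at least \<open>d\<close>.\<close>
  have lin: "\<bar>b\<bar> * d \<le> norm (of_real b * x + of_real c)" for b c :: real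
  proof (cases "b = 0")
    case False
    then have "of_real b * x + of_real c = of_real b * (x - of_real (- c / b))"
      by (simp add: algebra_simps)
    then have "norm (of_real b * x + of_real c) = \<bar>b\<bar> * norm (x - of_real (- c / b))"
      by (metis norm_mult norm_of_real)
    then show ?thesis using r[of "- c / b"] by (simp add: d_def mult_left_mono)
  qed simp
  let ?g = "\<lambda>(b, c). norm (x\<^sup>2 + of_real b * x + of_real c)"
  have "\<exists>y. \<forall>z. ?g y \<le> ?g z"
  proof (rule continuous_attains_inf_bounded_sublevel[of ?g "(0, 0)"])
    show "continuous_on UNIV ?g"
      by (simp add: case_prod_unfold) (intro continuous_intros)
    \<comment> \<open>On the sublevel set of the value at (0, 0), \<open>lin\<close> bounds
      \<open>b\<close>, and the triangle inequality then bounds \<open>c\<close>, so the set is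
      bounded and a minimum exists.\<close>
    have "\<bar>b\<bar> \<le> 2 * norm (x\<^sup>2) / d \<and> \<bar>c\<bar> \<le> 2 * norm (x\<^sup>2) + 2 * norm (x\<^sup>2) / d * norm x"
      if le: "norm (x\<^sup>2 + of_real b * x + of_real c) \<le> norm (x\<^sup>2)" for b c :: real
    proof -
      have "norm (of_real b * x + of_real c) \<le> norm (x\<^sup>2 + of_real b * x + of_real c) + norm (x\<^sup>2)"
        by (metis add.assoc add_diff_cancel_left' norm_triangle_ineq4)
      then have l: "norm (of_real b * x + of_real c) \<le> 2 * norm (x\<^sup>2)" using le by simp
      with lin[of b c] have b: "\<bar>b\<bar> \<le> 2 * norm (x\<^sup>2) / d" using d0 by (simp add: field_simps)
      have "norm (of_real c :: 'k) \<le> norm (of_real b * x + of_real c) + norm (of_real b * x)"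
        by (metis add_diff_cancel_left' norm_triangle_ineq4)
      then have "\<bar>c\<bar> \<le> 2 * norm (x\<^sup>2) + \<bar>b\<bar> * norm x" using l by (simp add: norm_mult)
      also have "\<dots> \<le> 2 * norm (x\<^sup>2) + 2 * norm (x\<^sup>2) / d * norm x"
        using b by (intro add_left_mono mult_right_mono) auto
      finally show ?thesis using b by blast
    qed
    then have "{p. ?g p \<le> ?g (0, 0)} \<subseteq> cball 0 (2 * norm (x\<^sup>2) / d) \<times> cball 0 (2 * norm (x\<^sup>2) + 2 * norm (x\<^sup>2) / d * norm x)"
      by auto
    then show "bounded {p. ?g p \<le> ?g (0, 0)}"
      by (rule bounded_subset[rotated]) (intro bounded_Times bounded_cball)
  qed
  then obtain y where "\<And>z. ?g y \<le> ?g z" by blast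
  then have "norm (x\<^sup>2 + of_real (fst y) * x + of_real (snd y)) \<le> norm (x\<^sup>2 + of_real b * x + of_real c)" for b c
    by (metis (mono_tags, lifting) case_prod_conv case_prod_beta)
  then show ?thesis using real_quadratic_root_of_attained_min by blast
qed

section \<open>Cardinality of the scalars and of sequences\<close>

text \<open>Reals are replaced by sets of naturals; a sequence of such sets is then coded as one set
  of pairs, their disjoint union.\<close>

lemma sequences_lepoll_real:
  assumes "(UNIV :: 'a set) \<lesssim> (UNIV :: real set)"
  shows "(UNIV :: (nat \<Rightarrow> 'a) set) \<lesssim> (UNIV :: real set)"
proof -
  have "(UNIV :: 'a set) \<lesssim> (UNIV :: nat set set)"
    using assms nat_sets_eqpoll_reals eqpoll_sym lepoll_trans2 by blast
  then obtain g :: "'a \<Rightarrow> nat set" where g: "inj g" by (auto simp: lepoll_def)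
  have "inj (\<lambda>f. {prod_encode (n, m) | n m. m \<in> g (f n)})"
  proof (rule injI)
    fix f f' assume eq: "{prod_encode (n, m) | n m. m \<in> g (f n)} = {prod_encode (n, m) | n m. m \<in> g (f' n)}"
    have "m \<in> g (f n) \<longleftrightarrow> prod_encode (n, m) \<in> {prod_encode (n, m) | n m. m \<in> g (f n)}" for f n m
      by auto
    with eq have "g (f n) = g (f' n)" for n by blast
    then show "f = f'" using g by (auto simp: inj_def)
  qed
  then have "(UNIV :: (nat \<Rightarrow> 'a) set) \<lesssim> (UNIV :: nat set set)" by (auto simp: lepoll_def)
  then show ?thesis using nat_sets_eqpoll_reals lepoll_trans2 by blast
qed

text \<open>An element is determined by the two coefficients of a real quadratic that it satisfies
  and one bit telling which of the at most two roots it is.\<close>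

lemma real_normed_field_lepoll_real: "(UNIV :: 'k::real_normed_field set) \<lesssim> (UNIV :: real set)"
proof -
  obtain b c :: "'k \<Rightarrow> real" where bc: "\<And>x. x\<^sup>2 + of_real (b x) * x + of_real (c x) = 0"
    using real_normed_field_quadratic by metis
  \<comment> \<open>A fixed root that depends on the coefficients only; for the coefficients
    belonging to some \<open>x\<close> the choice succeeds because \<open>x\<close> is a
    root.\<close>
  define r :: "real \<Rightarrow> real \<Rightarrow> 'k" where "r p q = (SOME x. x\<^sup>2 + of_real p * x + of_real q = 0)" for p q
  have r: "(r (b x) (c x))\<^sup>2 + of_real (b x) * r (b x) (c x) + of_real (c x) = 0" for x
    unfolding r_def by (rule someI[of _ x]) (rule bc)
  define h :: "'k \<Rightarrow> nat \<Rightarrow> real" where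
    "h x n = (if n = 0 then b x else if n = 1 then c x else of_bool (x = r (b x) (c x)))" for x n
  have "inj h"
  proof (rule injI)
    fix x y assume eq: "h x = h y"
    have bxy: "b x = b y" using fun_cong[OF eq, of 0] by (simp add: h_def)
    have cxy: "c x = c y" using fun_cong[OF eq, of 1] by (simp add: h_def)
    have rxy: "x = r (b x) (c x) \<longleftrightarrow> y = r (b x) (c x)"
      using fun_cong[OF eq, of 2] bxy cxy by (simp add: h_def of_bool_def split: if_splits)
    \<comment> \<open>Subtracting the two equations and cancelling the difference of the roots shows
      that the second root is forced: the roots sum to minus the linear coefficient.\<close>
    have other: "z = - of_real (b x) - r (b x) (c x)"
      if "z\<^sup>2 + of_real (b x) * z + of_real (c x) = 0" "z \<noteq> r (b x) (c x)" for z
    proof -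
      have "(z - r (b x) (c x)) * (z + r (b x) (c x) + of_real (b x)) =
        (z\<^sup>2 + of_real (b x) * z + of_real (c x))
          - ((r (b x) (c x))\<^sup>2 + of_real (b x) * r (b x) (c x) + of_real (c x))"
        by (simp add: power2_eq_square algebra_simps)
      also have "\<dots> = 0" unfolding that(1) r by simp
      finally have "(z - r (b x) (c x)) * (z + r (b x) (c x) + of_real (b x)) = 0" .
      then have "z + r (b x) (c x) + of_real (b x) = 0" using that(2) by simp
      then show ?thesis by (simp add: eq_diff_eq eq_neg_iff_add_eq_0 add.assoc)
    qed
    show "x = y"
    proof (cases "x = r (b x) (c x)")
      case False
      then have "x = - of_real (b x) - r (b x) (c x)" using bc[of x] by (rule other[rotated])
      moreover have "y = - of_real (b x) - r (b x) (c x)"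
        using bc[of y] False rxy unfolding bxy[symmetric] cxy[symmetric] by (intro other) auto
      ultimately show ?thesis by simp
    qed (use rxy in simp)
  qed
  then have "(UNIV :: 'k set) \<lesssim> (UNIV :: (nat \<Rightarrow> real) set)" by (auto simp: lepoll_def)
  then show ?thesis using sequences_lepoll_real[OF lepoll_refl] lepoll_trans by blast
qed

section \<open>An almost disjoint family of sets of naturals\<close>

text \<open>The nodes along the branch of the binary tree given by \<open>S\<close>. The length
  \<open>n\<close> is coded along with the initial segment, since segments of different lengths may
  be equal as sets.\<close>

definition branch_codes :: "nat set \<Rightarrow> nat set" where
  "branch_codes S = range (\<lambda>n. prod_encode (n, set_encode (S \<inter> {..<n})))"

lemma infinite_branch_codes: "infinite (branch_codes S)"
  unfolding branch_codes_def by (intro range_inj_infinite) (auto simp: inj_def)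

text \<open>If \<open>S\<close> and \<open>T\<close> differ at \<open>k\<close>, their segments of
  any length above \<open>k\<close> differ, so the branches share nodes of length at most
  \<open>k\<close> only.\<close>

lemma finite_branch_codes_Int:
  assumes "S \<noteq> T"
  shows "finite (branch_codes S \<inter> branch_codes T)"
proof -
  obtain k where k: "k \<in> S \<longleftrightarrow> k \<notin> T" using assms by blast
  have "n \<le> k" if "set_encode (S \<inter> {..<n}) = set_encode (T \<inter> {..<n})" for n
  proof (rule ccontr)
    assume "\<not> n \<le> k"
    moreover have "S \<inter> {..<n} = T \<inter> {..<n}" using that by (simp add: set_encode_eq)
    ultimately show False using k by (metis IntD1 IntI lessThan_iff not_le)
  qed
  then have "branch_codes S \<inter> branch_codes T \<subseteq> (\<lambda>n. prod_encode (n, set_encode (S \<inter> {..<n}))) ` {..k}"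
    by (auto simp: branch_codes_def)
  then show ?thesis by (rule finite_subset) simp
qed

section \<open>Closed subspaces of dimension continuum in quasi-Banach spaces\<close>

text \<open>A quasi-norm need not be continuous, so convergence is always expressed by
  \<open>N (s n - x)\<close> tending to 0 and handled through the inequality with constant
  \<open>C\<close>.\<close>

locale quasi_banach_subspace = vector_space scale
  for scale :: "'k::{real_normed_field,banach} \<Rightarrow> 'v::ab_group_add \<Rightarrow> 'v" (infixr "\<odot>" 75) +
  fixes E :: "'v set" and N :: "'v \<Rightarrow> real" and C :: real
  assumes subspace_E: "subspace E"
    and N_nonneg: "x \<in> E \<Longrightarrow> 0 \<le> N x"
    and N_eq_0: "x \<in> E \<Longrightarrow> N x = 0 \<longleftrightarrow> x = 0"
    and N_scale: "x \<in> E \<Longrightarrow> N (a \<odot> x) = norm a * N x"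
    and C_ge_1: "1 \<le> C"
    and N_add: "x \<in> E \<Longrightarrow> y \<in> E \<Longrightarrow> N (x + y) \<le> C * (N x + N y)"
    and N_complete: "(\<And>n. s n \<in> E) \<Longrightarrow> (\<And>\<epsilon>. \<epsilon> > 0 \<Longrightarrow> \<exists>M. \<forall>m\<ge>M. \<forall>n\<ge>M. N (s m - s n) < \<epsilon>)
      \<Longrightarrow> \<exists>x\<in>E. (\<lambda>n. N (s n - x)) \<longlonglongrightarrow> 0"
begin

lemmas E_simps = subspace_add[OF subspace_E] subspace_diff[OF subspace_E]
  subspace_scale[OF subspace_E] subspace_0[OF subspace_E] subspace_neg[OF subspace_E]

lemma N_minus: "x \<in> E \<Longrightarrow> N (- x) = N x"
  using N_scale[of x "-1"] by simp

lemma N_diff_commute: "x \<in> E \<Longrightarrow> y \<in> E \<Longrightarrow> N (x - y) = N (y - x)"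
  using N_minus[of "x - y"] E_simps by simp

lemma N_diff: "x \<in> E \<Longrightarrow> y \<in> E \<Longrightarrow> N (x - y) \<le> C * (N x + N y)"
  using N_add[of x "- y"] N_minus[of y] E_simps by simp

lemma span_subset_E: "S \<subseteq> E \<Longrightarrow> span S \<subseteq> E"
  using span_minimal subspace_E by blast

lemma N_tendsto_add:
  assumes "\<And>n. s n \<in> E" "\<And>n. t n \<in> E" "x \<in> E" "y \<in> E"
    and "(\<lambda>n. N (s n - x)) \<longlonglongrightarrow> 0" "(\<lambda>n. N (t n - y)) \<longlonglongrightarrow> 0"
  shows "(\<lambda>n. N ((s n + t n) - (x + y))) \<longlonglongrightarrow> 0"
proof (rule tendsto_sandwich[OF _ _ tendsto_const])
  have "N ((s n + t n) - (x + y)) \<le> C * (N (s n - x) + N (t n - y))" for n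
    using N_add[of "s n - x" "t n - y"] assms E_simps by (simp add: algebra_simps)
  then show "\<forall>\<^sub>F n in sequentially. N ((s n + t n) - (x + y)) \<le> C * (N (s n - x) + N (t n - y))"
    by simp
  have "(\<lambda>n. C * (N (s n - x) + N (t n - y))) \<longlonglongrightarrow> C * (0 + 0)"
    by (intro tendsto_intros assms)
  then show "(\<lambda>n. C * (N (s n - x) + N (t n - y))) \<longlonglongrightarrow> 0" by simp
qed (use assms E_simps N_nonneg in auto)

lemma N_tendsto_scale:
  assumes "\<And>n. s n \<in> E" "x \<in> E" and "(\<lambda>n. N (s n - x)) \<longlonglongrightarrow> 0"
  shows "(\<lambda>n. N (a \<odot> s n - a \<odot> x)) \<longlonglongrightarrow> 0"
proof -
  have "N (a \<odot> s n - a \<odot> x) = norm a * N (s n - x)" for n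
    using N_scale[of "s n - x" a] assms E_simps by (simp add: scale_right_diff_distrib)
  then show ?thesis using tendsto_mult_right_zero[OF assms(3)] by simp
qed

lemma N_tendsto_scale_left:
  assumes "a \<longlonglongrightarrow> b" "x \<in> E"
  shows "(\<lambda>n. N (a n \<odot> x - b \<odot> x)) \<longlonglongrightarrow> 0"
proof -
  have "N (a n \<odot> x - b \<odot> x) = norm (a n - b) * N x" for n
    using N_scale[of x "a n - b"] assms by (simp add: scale_left_diff_distrib)
  moreover have "(\<lambda>n. norm (a n - b)) \<longlonglongrightarrow> 0"
    by (intro tendsto_norm_zero LIM_zero assms)
  ultimately show ?thesis using tendsto_mult_left_zero[of "\<lambda>n. norm (a n - b)" sequentially "N x"] by simp
qed

lemma N_tendsto_sum:
  assumes "finite T" "\<And>i n. i \<in> T \<Longrightarrow> s i n \<in> E" "\<And>i. i \<in> T \<Longrightarrow> x i \<in> E"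
    and "\<And>i. i \<in> T \<Longrightarrow> (\<lambda>n. N (s i n - x i)) \<longlonglongrightarrow> 0"
  shows "(\<lambda>n. N ((\<Sum>i\<in>T. s i n) - (\<Sum>i\<in>T. x i))) \<longlonglongrightarrow> 0"
  using assms
proof (induction T rule: finite_induct)
  case empty
  then show ?case using N_eq_0[of 0] E_simps by simp
next
  case (insert i T)
  have "(\<lambda>n. N ((s i n + (\<Sum>i\<in>T. s i n)) - (x i + (\<Sum>i\<in>T. x i)))) \<longlonglongrightarrow> 0"
    using insert by (intro N_tendsto_add) (auto intro: subspace_sum[OF subspace_E])
  then show ?case using insert.hyps by simp
qed

lemma limit_unique:
  assumes "\<And>n. s n \<in> E" "x \<in> E" "y \<in> E"
    and "(\<lambda>n. N (s n - x)) \<longlonglongrightarrow> 0" "(\<lambda>n. N (s n - y)) \<longlonglongrightarrow> 0"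
  shows "x = y"
proof -
  have "N (x - y) \<le> C * (N (s n - y) + N (s n - x))" for n
    using N_diff[of "s n - y" "s n - x"] assms E_simps by simp
  moreover have "(\<lambda>n. C * (N (s n - y) + N (s n - x))) \<longlonglongrightarrow> C * (0 + 0)"
    by (intro tendsto_intros assms)
  ultimately have "N (x - y) \<le> C * (0 + 0)" by (intro LIMSEQ_le_const) auto
  then have "N (x - y) = 0" using N_nonneg[of "x - y"] assms E_simps by simp
  then show ?thesis using N_eq_0[of "x - y"] assms E_simps by simp
qed

text \<open>Peeling off the first summand repeatedly charges summand \<open>k\<close> with
  \<open>Suc k\<close> factors \<open>C\<close>; the induction therefore runs over shifted
  sequences.\<close>

lemma N_sum_le:
  assumes "\<And>k. v k \<in> E"
  shows "N (\<Sum>k<n. v k) \<le> (\<Sum>k<n. C ^ Suc k * N (v k))"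
  using assms
proof (induction n arbitrary: v)
  case 0
  then show ?case using N_eq_0[of 0] E_simps by simp
next
  case (Suc n)
  have "N (\<Sum>k<Suc n. v k) = N (v 0 + (\<Sum>k<n. v (Suc k)))"
    by (simp only: sum.lessThan_Suc_shift)
  also have "\<dots> \<le> C * (N (v 0) + N (\<Sum>k<n. v (Suc k)))"
    using Suc.prems by (intro N_add subspace_sum[OF subspace_E]) auto
  also have "\<dots> \<le> C * (N (v 0) + (\<Sum>k<n. C ^ Suc k * N (v (Suc k))))"
    using C_ge_1 Suc.prems by (intro mult_left_mono add_left_mono Suc.IH) auto
  also have "\<dots> = (\<Sum>k<Suc n. C ^ Suc k * N (v k))"
    by (simp only: sum.lessThan_Suc_shift) (simp add: algebra_simps sum_distrib_left)
  finally show ?case .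
qed

text \<open>With this ratio \<open>C * \<eta>\<close> is 1/(4C): after the powers of
  \<open>C\<close> from \<open>N_sum_le\<close> are paid, the terms still decay like powers of 1/4
  and a factor 1/C is left to absorb one more use of the quasi-triangle inequality.\<close>

abbreviation (input) "\<eta> \<equiv> 1 / (4 * C\<^sup>2)"

lemma N_sum_geometric:
  assumes v: "\<And>k. v k \<in> E" and le: "\<And>k. N (v k) \<le> B * \<eta> ^ Suc k"
  shows "N (\<Sum>k<n. v k) \<le> B / (3 * C)"
proof -
  have C0: "C > 0" using C_ge_1 by simp
  have "0 \<le> B * \<eta> ^ Suc 0" using le[of 0] N_nonneg[OF v[of 0]] by linarith
  then have B0: "B \<ge> 0" using C0 by (simp add: zero_le_divide_iff)
  have tm: "C ^ Suc k * N (v k) \<le> B / C * (1/4) ^ Suc k" for k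
  proof -
    have "C ^ Suc k * N (v k) \<le> C ^ Suc k * (B * \<eta> ^ Suc k)"
      using C0 le by (intro mult_left_mono) auto
    also have "\<dots> = B * (C * \<eta>) ^ Suc k" by (simp only: power_mult_distrib mult_ac)
    also have "C * \<eta> = 1 / C * (1/4)" using C0 by (simp add: power2_eq_square)
    also have "B * (1 / C * (1/4)) ^ Suc k = B * ((1 / C) ^ Suc k * (1/4) ^ Suc k)"
      by (simp only: power_mult_distrib)
    \<comment> \<open>Of the \<open>Suc k\<close> factors 1/C only one is kept; the others are at
      most 1.\<close>
    also have "\<dots> \<le> B * (1 / C * (1/4) ^ Suc k)"
      using B0 C_ge_1 power_le_one[of "1 / C" k] C0
      by (intro mult_left_mono mult_right_mono) (auto simp: field_simps)
    finally show ?thesis by simp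
  qed
  have geo: "(\<Sum>k<n. (1/4::real) ^ Suc k) \<le> 1/3"
  proof -
    have "(\<Sum>k<n. (1/4::real) ^ Suc k) = (1 - (1/4) ^ n) / 3" by (induction n) simp_all
    then show ?thesis by simp
  qed
  have "N (\<Sum>k<n. v k) \<le> (\<Sum>k<n. B / C * (1/4) ^ Suc k)"
    using N_sum_le[of v n, OF v] sum_mono[of "{..<n}", OF tm] by (meson order_trans)
  also have "\<dots> = B / C * (\<Sum>k<n. (1/4) ^ Suc k)" by (simp only: sum_distrib_left)
  also have "\<dots> \<le> B / C * (1/3)" using geo B0 C0 by (intro mult_left_mono) auto
  finally show ?thesis by simp
qed

definition nclosed :: "'v set \<Rightarrow> bool" where
  "nclosed M \<longleftrightarrow> (\<forall>s x. (\<forall>n. s n \<in> M) \<and> x \<in> E \<and> (\<lambda>n. N (s n - x)) \<longlonglongrightarrow> 0 \<longrightarrow> x \<in> M)"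

lemma nclosedD:
  "nclosed M \<Longrightarrow> (\<And>n. s n \<in> M) \<Longrightarrow> x \<in> E \<Longrightarrow> (\<lambda>n. N (s n - x)) \<longlonglongrightarrow> 0 \<Longrightarrow> x \<in> M"
  unfolding nclosed_def by blast

text \<open>Otherwise elements of \<open>M\<close> closer than 1/(n+1) to \<open>e\<close> would
  converge to \<open>e\<close>. The homogeneous form with the scalar \<open>a\<close> lets
  coefficients of \<open>e\<close> be estimated from norms.\<close>

lemma dist_nclosed_pos:
  assumes M: "subspace M" "M \<subseteq> E" "nclosed M" and e: "e \<in> E" "e \<notin> M"
  obtains \<delta> where "\<delta> > 0" "\<And>a m. m \<in> M \<Longrightarrow> norm a * \<delta> \<le> N (m + a \<odot> e)"
proof -
  have "\<exists>n. \<forall>m\<in>M. 1 / real (Suc n) \<le> N (m - e)"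
  proof (rule ccontr)
    assume "\<not> ?thesis"
    then obtain s where s: "\<And>n. s n \<in> M" "\<And>n. N (s n - e) < 1 / real (Suc n)"
      by (metis not_le)
    have "(\<lambda>n. N (s n - e)) \<longlonglongrightarrow> 0"
    proof (rule tendsto_sandwich[OF _ _ tendsto_const])
      show "\<forall>\<^sub>F n in sequentially. N (s n - e) \<le> 1 / real (Suc n)" using s less_imp_le by (intro always_eventually) blast
      show "(\<lambda>n. 1 / real (Suc n)) \<longlonglongrightarrow> 0" using LIMSEQ_Suc[OF lim_1_over_n] by simp
      show "\<forall>\<^sub>F n in sequentially. 0 \<le> N (s n - e)"
        using s(1) M(2) e(1) by (intro always_eventually allI N_nonneg E_simps) auto
    qed
    with M(3) s(1) e(1) have "e \<in> M" by (rule nclosedD)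
    then show False using e(2) by blast
  qed
  then obtain n where n: "\<And>m. m \<in> M \<Longrightarrow> 1 / real (Suc n) \<le> N (m - e)" by blast
  show ?thesis
  proof (rule that[of "1 / real (Suc n)"])
    fix a m assume m: "m \<in> M"
    show "norm a * (1 / real (Suc n)) \<le> N (m + a \<odot> e)"
    proof (cases "a = 0")
      case True
      then show ?thesis using N_nonneg m M(2) by auto
    next
      case False
      let ?m = "- inverse a \<odot> m"
      have m': "?m \<in> M" using M(1) m by (rule subspace_scale)
      have "m + a \<odot> e = - a \<odot> (?m - e)" using False by (simp add: scale_right_diff_distrib)
      then have "N (m + a \<odot> e) = norm a * N (?m - e)"
        using N_scale[of "?m - e" "- a"] m' M(2) e(1) E_simps by auto
      then show ?thesis using mult_left_mono[OF n[OF m'] norm_ge_zero[of a]] by simp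
    qed
  qed simp
qed

text \<open>The positive distance of \<open>e\<close> from \<open>M\<close> makes the coefficients
  of \<open>e\<close> along a convergent sequence Cauchy. They converge because the field is
  complete, and subtracting the \<open>e\<close> part leaves a convergent sequence in
  \<open>M\<close>.\<close>

lemma nclosed_span_insert:
  assumes M: "subspace M" "M \<subseteq> E" "nclosed M" and e: "e \<in> E"
  shows "nclosed (span (insert e M))"
proof (cases "e \<in> M")
  case True
  then show ?thesis using M by (simp add: insert_absorb span_eq_iff[THEN iffD2])
next
  case False
  obtain \<delta> where \<delta>: "\<delta> > 0" "\<And>a m. m \<in> M \<Longrightarrow> norm a * \<delta> \<le> N (m + a \<odot> e)"
    using dist_nclosed_pos[OF M e False] by blast
  have memb: "x \<in> span (insert e M) \<longleftrightarrow> (\<exists>k. x - k \<odot> e \<in> M)" for x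
  proof -
    have "span M = M" using M(1) by (simp only: span_eq_iff)
    then show ?thesis by (simp only: span_breakdown_eq)
  qed
  show ?thesis unfolding nclosed_def
  proof (intro allI impI, elim conjE)
    fix s x assume s: "\<forall>n. s n \<in> span (insert e M)" and x: "x \<in> E" and lim: "(\<lambda>n. N (s n - x)) \<longlonglongrightarrow> 0"
    from s obtain a where a: "\<And>n. s n - a n \<odot> e \<in> M" unfolding memb by metis
    have sE: "s n \<in> E" for n using s span_subset_E[of "insert e M"] M(2) e by blast
    have "Cauchy a"
    proof (rule metric_CauchyI)
      fix \<epsilon> :: real assume \<epsilon>: "\<epsilon> > 0"
      \<comment> \<open>Chosen so that \<open>C * (r + r)\<close> is exactly
        \<open>\<epsilon> * \<delta>\<close>.\<close>
      define r where "r = \<epsilon> * \<delta> / (2 * C)"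
      have "r > 0" using \<epsilon> \<delta>(1) C_ge_1 by (simp add: r_def)
      then obtain K where K: "\<And>n. n \<ge> K \<Longrightarrow> N (s n - x) < r"
        using order_tendstoD(2)[OF lim] unfolding eventually_sequentially by blast
      show "\<exists>K. \<forall>m\<ge>K. \<forall>n\<ge>K. dist (a m) (a n) < \<epsilon>"
      proof (intro exI allI impI)
        fix m n assume mn: "m \<ge> K" "n \<ge> K"
        have "norm (a m - a n) * \<delta> \<le> N (((s m - a m \<odot> e) - (s n - a n \<odot> e)) + (a m - a n) \<odot> e)"
          by (intro \<delta>(2) subspace_diff M a)
        also have "\<dots> = N ((s m - x) - (s n - x))" by (simp add: scale_left_diff_distrib algebra_simps)
        also have "\<dots> \<le> C * (N (s m - x) + N (s n - x))" using sE x by (intro N_diff E_simps)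
        also have "\<dots> < C * (r + r)" using K mn C_ge_1 by (intro mult_strict_left_mono add_strict_mono) auto
        also have "\<dots> = \<epsilon> * \<delta>" using C_ge_1 by (simp add: r_def field_simps)
        finally show "dist (a m) (a n) < \<epsilon>" using \<delta>(1) by (simp add: dist_norm)
      qed
    qed
    then obtain b where b: "a \<longlonglongrightarrow> b" using Cauchy_convergent convergent_def by blast
    have "(\<lambda>n. N ((s n + (-1) \<odot> (a n \<odot> e)) - (x + (-1) \<odot> (b \<odot> e)))) \<longlonglongrightarrow> 0"
      using sE x e lim by (intro N_tendsto_add N_tendsto_scale N_tendsto_scale_left b E_simps)
    then have "(\<lambda>n. N ((s n - a n \<odot> e) - (x - b \<odot> e))) \<longlonglongrightarrow> 0" by (simp add: algebra_simps)
    then have "x - b \<odot> e \<in> M" using x e by (intro nclosedD[OF M(3) a] E_simps)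
    then show "x \<in> span (insert e M)" unfolding memb by blast
  qed
qed

lemma nclosed_span_finite:
  assumes "finite S" "S \<subseteq> E"
  shows "nclosed (span S)"
  using assms
proof (induction S rule: finite_induct)
  case empty
  have "x = 0" if "x \<in> E" "(\<lambda>n. N (0 - x)) \<longlonglongrightarrow> 0" for x
    using that N_minus N_eq_0 LIMSEQ_unique[OF that(2) tendsto_const] by simp
  then show ?case by (auto simp: nclosed_def)
next
  case (insert e S)
  have "nclosed (span (insert e (span S)))"
    using insert span_subset_E by (intro nclosed_span_insert) auto
  moreover have "span (insert e (span S)) = span (insert e S)"
    by (simp only: span_insert span_span)
  ultimately show ?case by simp
qed


lemma C_pos: "C > 0"
  using C_ge_1 by simp

section \<open>Subsums of a rapidly decreasing independent sequence\<close>

text \<open>Rescaling suffices: a positive factor on \<open>u n\<close> scales both its quasi-norm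
  and its distance from the span of the predecessors, and does not enlarge that span. Each factor is
  chosen after the preceding one.\<close>

lemma rapidly_decreasing_sequence:
  fixes u :: "nat \<Rightarrow> 'v"
  assumes u: "\<And>n. u n \<in> E" "\<And>n. u n \<notin> span (u ` {..<n})"
  obtains e :: "nat \<Rightarrow> 'v" and \<delta> :: "nat \<Rightarrow> real"
  where "\<And>n. e n \<in> span (range u)" "\<And>n. \<delta> n > 0"
    "\<And>n a m. m \<in> span (e ` {..<n}) \<Longrightarrow> norm a * \<delta> n \<le> N (m + a \<odot> e n)"
    "\<And>n. N (e (Suc n)) \<le> \<eta> * \<delta> n"
proof -
  have uE: "u ` S \<subseteq> E" for S using u(1) by blast
  have "\<exists>\<delta>>0. \<forall>a. \<forall>m\<in>span (u ` {..<n}). norm a * \<delta> \<le> N (m + a \<odot> u n)" for n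
  proof -
    have "nclosed (span (u ` {..<n}))" by (rule nclosed_span_finite) (use uE in auto)
    then obtain \<delta> where "\<delta> > 0" "\<And>a m. m \<in> span (u ` {..<n}) \<Longrightarrow> norm a * \<delta> \<le> N (m + a \<odot> u n)"
      using dist_nclosed_pos[OF subspace_span span_subset_E[OF uE] _ u(1) u(2)[of n]] by blast
    then show ?thesis by blast
  qed
  then obtain d where d: "\<And>n. d n > 0"
    "\<And>n a m. m \<in> span (u ` {..<n}) \<Longrightarrow> norm a * d n \<le> N (m + a \<odot> u n)"
    by metis
  have "u n \<noteq> 0" for n using u(2)[of n] span_zero by metis
  then have Nu: "N (u n) > 0" for n using N_nonneg[OF u(1)] N_eq_0[OF u(1)] by (metis less_eq_real_def)
  \<comment> \<open>The recursion makes \<open>N (e (Suc n))\<close> equal to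
    \<open>\<eta> * (t n * d n)\<close>.\<close>
  define t where "t = rec_nat (1::real) (\<lambda>n r. r * d n * \<eta> / N (u (Suc n)))"
  have t0: "t 0 = 1" and tS: "t (Suc n) = t n * d n * \<eta> / N (u (Suc n))" for n
    by (simp_all add: t_def)
  have t: "t n > 0" for n
  proof (induction n)
    case (Suc n)
    then show ?case unfolding tS using d(1) Nu C_pos by simp
  qed (simp add: t0)
  define e where "e n = of_real (t n) \<odot> u n" for n
  have es: "e ` {..<n} \<subseteq> span (u ` {..<n})" for n
    by (auto simp: e_def intro!: span_scale[OF span_base])
  show ?thesis
  proof (rule that[of e "\<lambda>n. t n * d n"])
    show "e n \<in> span (range u)" for n by (auto simp: e_def intro!: span_scale[OF span_base])
    show "t n * d n > 0" for n using t d(1) by simp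
    show "norm a * (t n * d n) \<le> N (m + a \<odot> e n)" if "m \<in> span (e ` {..<n})" for n a m
    proof -
      have "m \<in> span (u ` {..<n})" using that span_minimal[OF es subspace_span] by blast
      from d(2)[OF this, of "a * of_real (t n)"] show ?thesis
        using t[of n] by (simp add: e_def norm_mult mult_ac)
    qed
    show "N (e (Suc n)) \<le> \<eta> * (t n * d n)" for n
    proof -
      have "N (e (Suc n)) = t (Suc n) * N (u (Suc n))"
        using N_scale[OF u(1)] t[of "Suc n"] by (simp add: e_def)
      also have "\<dots> = \<eta> * (t n * d n)" unfolding tS using Nu[of "Suc n"] by simp
      finally show ?thesis by simp
    qed
  qed
qed

context
  fixes e :: "nat \<Rightarrow> 'v" and \<delta> :: "nat \<Rightarrow> real"
  assumes e_E: "\<And>n. e n \<in> E"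
    and \<delta>_pos: "\<And>n. \<delta> n > 0"
    and \<delta>_dist: "\<And>n a m. m \<in> span (e ` {..<n}) \<Longrightarrow> norm a * \<delta> n \<le> N (m + a \<odot> e n)"
    and N_e_Suc: "\<And>n. N (e (Suc n)) \<le> \<eta> * \<delta> n"
begin

abbreviation (input) "psum d n \<equiv> (\<Sum>j<n. d j \<odot> e j)"

lemma psum_in_E: "psum d n \<in> E"
  using e_E by (intro subspace_sum[OF subspace_E] E_simps)

lemma \<eta>_pos: "\<eta> > 0" and \<eta>_less_1: "\<eta> < 1"
proof -
  show "\<eta> > 0" using C_pos by simp
  have "C\<^sup>2 \<ge> 1" using C_ge_1 by (simp add: one_le_power)
  then have "4 * C\<^sup>2 > 1" by linarith
  then show "\<eta> < 1" by (subst divide_less_eq_1_pos) linarith+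
qed

text \<open>The distance \<open>\<delta> n\<close> is at most \<open>N (e n)\<close>, the distance
  from 0, so every use of \<open>N_e_Suc\<close> gains a factor \<open>\<eta>\<close>.\<close>

lemma N_e_le: "N (e (Suc n + k)) \<le> \<delta> n * \<eta> ^ Suc k"
proof (induction k)
  case 0
  then show ?case using N_e_Suc[of n] by (simp add: mult.commute)
next
  case (Suc k)
  have "\<delta> (Suc n + k) \<le> N (e (Suc n + k))" using \<delta>_dist[of 0 _ 1] span_zero by simp
  then have "\<eta> * \<delta> (Suc n + k) \<le> \<eta> * (\<delta> n * \<eta> ^ Suc k)"
    using Suc.IH \<eta>_pos by (intro mult_left_mono) auto
  then show ?case using N_e_Suc[of "Suc n + k"] by (simp add: mult_ac)
qed

text \<open>What comes after index \<open>n\<close> is small compared with the distance of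
  \<open>e n\<close> from its predecessors, so a tail cannot cancel a component along
  \<open>e n\<close>.\<close>

lemma N_block_le:
  assumes "\<And>k. norm (d (Suc n + k)) \<le> B"
  shows "N (\<Sum>k<m. d (Suc n + k) \<odot> e (Suc n + k)) \<le> B * \<delta> n / (3 * C)"
proof (rule N_sum_geometric)
  fix k
  show "d (Suc n + k) \<odot> e (Suc n + k) \<in> E" using e_E by (intro E_simps)
  have "N (d (Suc n + k) \<odot> e (Suc n + k)) = norm (d (Suc n + k)) * N (e (Suc n + k))"
    by (rule N_scale[OF e_E])
  also have "\<dots> \<le> B * (\<delta> n * \<eta> ^ Suc k)"
    using assms[of k] N_e_le N_nonneg[OF e_E] by (intro mult_mono) (auto intro: order_trans[OF norm_ge_zero])
  finally show "N (d (Suc n + k) \<odot> e (Suc n + k)) \<le> B * \<delta> n * \<eta> ^ Suc k" by (simp only: mult.assoc)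
qed

lemma psum_split: "psum d (n + m) = psum d n + (\<Sum>k<m. d (n + k) \<odot> e (n + k))"
  by (induction m) (simp_all add: add.assoc)

lemma psum_converges:
  assumes B: "\<And>k. norm (d k) \<le> B"
  shows "\<exists>x\<in>E. (\<lambda>n. N (psum d n - x)) \<longlonglongrightarrow> 0"
proof (rule N_complete)
  show "psum d n \<in> E" for n by (rule psum_in_E)
  fix \<epsilon> :: real assume \<epsilon>: "\<epsilon> > 0"
  have B0: "B \<ge> 0" using B[of 0] norm_ge_zero order_trans by blast
  have "(\<lambda>n. B * (\<delta> 0 * \<eta> ^ Suc n) / (3 * C)) \<longlonglongrightarrow> B * (\<delta> 0 * 0) / (3 * C)"
    using \<eta>_pos \<eta>_less_1 C_pos
    by (intro tendsto_intros LIMSEQ_Suc LIMSEQ_power_zero) auto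
  then have "\<forall>\<^sub>F n in sequentially. B * (\<delta> 0 * \<eta> ^ Suc n) / (3 * C) < \<epsilon>"
    using \<epsilon> by (intro order_tendstoD(2)) auto
  then obtain K where K: "\<And>n. n \<ge> K \<Longrightarrow> B * (\<delta> 0 * \<eta> ^ Suc n) / (3 * C) < \<epsilon>"
    unfolding eventually_sequentially by blast
  have half: "N (psum d (n + m) - psum d n) < \<epsilon>" if n: "n \<ge> Suc (Suc K)" for n m
  proof -
    \<comment> \<open>The tail from \<open>n\<close> is measured by \<open>\<delta> (Suc p)\<close>,
      and \<open>N_e_le\<close> bounds \<open>e\<close> from index 1 on only; this accounts for the
      shift by two.\<close>
    obtain p where p: "n = Suc (Suc p)" "p \<ge> K" using n by (metis Suc_le_D Suc_le_mono)
    have "\<delta> (Suc p) \<le> N (e (Suc p))" using \<delta>_dist[of 0 _ 1] span_zero by simp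
    also have "\<dots> \<le> \<delta> 0 * \<eta> ^ Suc p" using N_e_le[of 0 p] by simp
    finally have \<delta>p: "\<delta> (Suc p) \<le> \<delta> 0 * \<eta> ^ Suc p" .
    have "psum d (n + m) - psum d n = (\<Sum>k<m. d (Suc (Suc p) + k) \<odot> e (Suc (Suc p) + k))"
      unfolding psum_split p(1) by simp
    then have "N (psum d (n + m) - psum d n) \<le> B * \<delta> (Suc p) / (3 * C)"
      using N_block_le[of d "Suc p" B m] B by simp
    also have "\<dots> \<le> B * (\<delta> 0 * \<eta> ^ Suc p) / (3 * C)"
      using B0 C_pos \<delta>p by (intro divide_right_mono mult_left_mono) auto
    also have "\<dots> < \<epsilon>" using K[OF p(2)] .
    finally show ?thesis .
  qed
  show "\<exists>M. \<forall>m\<ge>M. \<forall>n\<ge>M. N (psum d m - psum d n) < \<epsilon>"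
  proof (intro exI allI impI)
    fix m n assume mn: "m \<ge> Suc (Suc K)" "n \<ge> Suc (Suc K)"
    show "N (psum d m - psum d n) < \<epsilon>"
    proof (cases "n \<le> m")
      case True
      then show ?thesis using half[OF mn(2), of "m - n"] by simp
    next
      case False
      then show ?thesis using half[OF mn(1), of "n - m"] N_diff_commute[OF psum_in_E psum_in_E] by simp
    qed
  qed
qed

text \<open>Up to index \<open>i\<close> the sum has quasi-norm at least
  \<open>norm (d i) * \<delta> i\<close>, whatever the earlier coefficients are. The tail costs at
  most a third of this, and the remainder bounds all longer partial sums from below.\<close>

lemma psum_not_tendsto_0:
  assumes di: "d i \<noteq> 0" and le: "\<And>j. j > i \<Longrightarrow> norm (d j) \<le> norm (d i)"
  shows "\<not> (\<lambda>n. N (psum d n)) \<longlonglongrightarrow> 0"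
proof
  assume lim: "(\<lambda>n. N (psum d n)) \<longlonglongrightarrow> 0"
  let ?r = "norm (d i) * \<delta> i"
  have r: "?r > 0" using di \<delta>_pos by simp
  have bound: "?r \<le> C * N (psum d (Suc i + k)) + ?r / 3" for k
  proof -
    let ?t = "\<Sum>k<k. d (Suc i + k) \<odot> e (Suc i + k)"
    have tE: "?t \<in> E" using e_E by (intro subspace_sum[OF subspace_E] E_simps)
    have "?r \<le> N (psum d i + d i \<odot> e i)"
      by (intro \<delta>_dist span_sum span_scale span_base) auto
    also have "psum d i + d i \<odot> e i = psum d (Suc i + k) - ?t"
      unfolding psum_split by simp
    also have "N \<dots> \<le> C * (N (psum d (Suc i + k)) + N ?t)" by (intro N_diff psum_in_E tE)
    also have "\<dots> \<le> C * (N (psum d (Suc i + k)) + ?r / (3 * C))"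
      using le C_pos by (intro mult_left_mono add_left_mono N_block_le) auto
    also have "\<dots> = C * N (psum d (Suc i + k)) + ?r / 3" using C_pos by (simp add: field_simps)
    finally show ?thesis .
  qed
  have "(\<lambda>k. C * N (psum d (Suc i + k)) + ?r / 3) \<longlonglongrightarrow> C * 0 + ?r / 3"
    using LIMSEQ_ignore_initial_segment[OF lim, of "Suc i"]
    by (intro tendsto_intros) (simp add: add.commute)
  then have "?r \<le> C * 0 + ?r / 3" by (rule LIMSEQ_le_const) (use bound in blast)
  then show False using r by linarith
qed

text \<open>Here \<open>w S\<close> is the sum of the \<open>e j\<close> over \<open>j\<close> in
  \<open>branch_codes S\<close>. Since these sets are almost disjoint, different \<open>w S\<close>
  can interact at finitely many indices only. The last clause serves to place \<open>w S\<close> in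
  a closure.\<close>

lemma continuum_independent_family:
  obtains w :: "nat set \<Rightarrow> 'v"
  where "inj w" "independent (range w)" "\<And>S. w S \<in> E"
    "\<And>S. \<exists>d. (\<lambda>n. N (psum d n - w S)) \<longlonglongrightarrow> 0"
proof -
  define sel :: "nat set \<Rightarrow> nat \<Rightarrow> 'k" where "sel S j = of_bool (j \<in> branch_codes S)" for S j
  have "\<exists>x\<in>E. (\<lambda>n. N (psum (sel S) n - x)) \<longlonglongrightarrow> 0" for S
    by (rule psum_converges[of _ 1]) (simp add: sel_def of_bool_def)
  then obtain w where w: "\<And>S. w S \<in> E" "\<And>S. (\<lambda>n. N (psum (sel S) n - w S)) \<longlonglongrightarrow> 0" by metis
  have coeff: "c S = 0" if T: "finite T" "(\<Sum>S\<in>T. c S \<odot> w S) = 0" "S \<in> T" for c T S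
  proof (rule ccontr)
    assume cS: "c S \<noteq> 0"
    define d where "d j = (\<Sum>S\<in>T. c S * sel S j)" for j
    \<comment> \<open>A coefficient of largest norm meets the domination hypothesis of
      \<open>psum_not_tendsto_0\<close> at late indices of its branch.\<close>
    obtain R where R: "R \<in> T" "\<And>S. S \<in> T \<Longrightarrow> norm (c S) \<le> norm (c R)"
    proof -
      let ?A = "(\<lambda>S. norm (c S)) ` T"
      have "finite ?A" "?A \<noteq> {}" using T by auto
      then obtain R where "R \<in> T" "norm (c R) = Max ?A" using Max_in[of ?A] by fastforce
      with \<open>finite ?A\<close> that show ?thesis by simp
    qed
    have cR: "c R \<noteq> 0" using R(2)[OF T(3)] cS by auto
    \<comment> \<open>All overlaps between the finitely many branches. Beyond \<open>k\<close>, a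
      bound for \<open>F\<close>, each \<open>d j\<close> is either 0 or a single
      \<open>c S\<close>.\<close>
    define F where "F = (\<Union>(S, S')\<in>{(S, S'). S \<in> T \<and> S' \<in> T \<and> S \<noteq> S'}. branch_codes S \<inter> branch_codes S')"
    have "finite F" unfolding F_def
    proof (rule finite_UN_I)
      show "finite {(S, S'). S \<in> T \<and> S' \<in> T \<and> S \<noteq> S'}"
        by (rule finite_subset[of _ "T \<times> T"]) (use T(1) in auto)
    qed (auto intro: finite_branch_codes_Int)
    then obtain k where k: "F \<subseteq> {..<k}" using finite_nat_bounded by blast
    have d_eq: "d j = c S" if "S \<in> T" "j \<in> branch_codes S" "j \<ge> k" for j S
    proof -
      have "d j = (\<Sum>S'\<in>T. if S' = S then c S else 0)"
        unfolding d_def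
      proof (rule sum.cong[OF refl])
        fix S' assume "S' \<in> T"
        have "j \<notin> F" using that(3) k by auto
        then have "S' = S \<or> j \<notin> branch_codes S'"
          using \<open>S' \<in> T\<close> that(1,2) unfolding F_def by blast
        then show "c S' * sel S' j = (if S' = S then c S else 0)" using that(2) by (auto simp: sel_def)
      qed
      then show ?thesis using T(1) that(1) by simp
    qed
    have d_le: "norm (d j) \<le> norm (c R)" if "j \<ge> k" for j
    proof (cases "\<exists>S\<in>T. j \<in> branch_codes S")
      case True
      then show ?thesis using d_eq that R(2) by metis
    next
      case False
      then have "d j = 0" by (auto simp: d_def sel_def intro: sum.neutral)
      then show ?thesis by simp
    qed
    obtain i where i: "i \<ge> k" "i \<in> branch_codes R"
      using infinite_branch_codes[of R] infinite_nat_iff_unbounded_le by blast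
    have di: "d i = c R" by (rule d_eq[OF R(1) i(2,1)])
    have "\<not> (\<lambda>n. N (psum d n)) \<longlonglongrightarrow> 0"
      using di cR d_le i(1) by (intro psum_not_tendsto_0[of d i]) auto
    \<comment> \<open>On the other hand, the partial sums with coefficients \<open>d\<close>
      converge to the combination of the \<open>w S\<close>, which is 0.\<close>
    moreover have "(\<lambda>n. N ((\<Sum>S\<in>T. c S \<odot> psum (sel S) n) - (\<Sum>S\<in>T. c S \<odot> w S))) \<longlonglongrightarrow> 0"
      using T(1) w psum_in_E by (intro N_tendsto_sum N_tendsto_scale E_simps)
    moreover have "(\<Sum>S\<in>T. c S \<odot> psum (sel S) n) = psum d n" for n
      unfolding d_def scale_sum_left scale_sum_right scale_scale by (rule sum.swap)
    ultimately show False unfolding T(2) by simp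
  qed
  have inj: "inj w"
  proof (rule injI, rule ccontr)
    fix S S' assume *: "w S = w S'" "S \<noteq> S'"
    then have "(\<Sum>R\<in>{S, S'}. (if R = S then 1 else - 1) \<odot> w R) = 0" by simp
    from coeff[OF _ this, of S] show False by simp
  qed
  have "independent (range w)"
    unfolding independent_explicit_module
  proof (intro allI impI)
    fix t c v assume t: "finite t" "t \<subseteq> range w" "(\<Sum>v\<in>t. c v \<odot> v) = 0" "v \<in> t"
    define T where "T = w -` t"
    have tT: "t = w ` T" using t(2) by (auto simp: T_def)
    have fT: "finite T" unfolding T_def by (rule finite_vimageI[OF t(1) inj])
    have "(\<Sum>S\<in>T. c (w S) \<odot> w S) = 0"
      using t(3) unfolding tT by (subst (asm) sum.reindex) (auto intro: inj_on_subset[OF inj])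
    from coeff[OF fT this] show "c v = 0" using t(4) unfolding tT by auto
  qed
  with inj w that show ?thesis by blast
qed

end

section \<open>Closure and dimension of a countably generated subspace\<close>

definition nclosure :: "'v set \<Rightarrow> 'v set" where
  "nclosure S = {w\<in>E. \<exists>s. (\<forall>n. s n \<in> S) \<and> (\<lambda>n. N (s n - w)) \<longlonglongrightarrow> 0}"

lemma nclosure_superset: "S \<subseteq> E \<Longrightarrow> S \<subseteq> nclosure S"
  using N_eq_0[of 0] E_simps by (auto simp: nclosure_def intro!: exI[of _ "\<lambda>_. x" for x])

lemma subspace_nclosure:
  assumes S: "subspace S" "S \<subseteq> E"
  shows "subspace (nclosure S)"
proof (rule subspaceI)
  show "0 \<in> nclosure S" using nclosure_superset[OF S(2)] subspace_0[OF S(1)] by blast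
  show "x + y \<in> nclosure S" if "x \<in> nclosure S" "y \<in> nclosure S" for x y
  proof -
    from that obtain s t where st: "\<And>n. s n \<in> S" "\<And>n. t n \<in> S" "x \<in> E" "y \<in> E"
      "(\<lambda>n. N (s n - x)) \<longlonglongrightarrow> 0" "(\<lambda>n. N (t n - y)) \<longlonglongrightarrow> 0"
      unfolding nclosure_def by blast
    then have "(\<lambda>n. N ((s n + t n) - (x + y))) \<longlonglongrightarrow> 0"
      using S(2) by (intro N_tendsto_add) auto
    then show ?thesis using st E_simps subspace_add[OF S(1)] unfolding nclosure_def
      by (auto intro!: exI[of _ "\<lambda>n. s n + t n"])
  qed
  show "a \<odot> x \<in> nclosure S" if "x \<in> nclosure S" for a x
  proof -
    from that obtain s where s: "\<And>n. s n \<in> S" "x \<in> E" "(\<lambda>n. N (s n - x)) \<longlonglongrightarrow> 0"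
      unfolding nclosure_def by blast
    then have "(\<lambda>n. N (a \<odot> s n - a \<odot> x)) \<longlonglongrightarrow> 0"
      using S(2) by (intro N_tendsto_scale) auto
    then show ?thesis using s E_simps subspace_scale[OF S(1)] unfolding nclosure_def
      by (auto intro!: exI[of _ "\<lambda>n. a \<odot> s n"])
  qed
qed

text \<open>One passage to limits is enough: each \<open>s n\<close> is replaced by an element of
  \<open>S\<close> within 1/(n+1) of it, and the quasi-triangle inequality shows that the new
  sequence has the same limit.\<close>

lemma nclosed_nclosure:
  assumes S: "S \<subseteq> E"
  shows "nclosed (nclosure S)"
  unfolding nclosed_def
proof (intro allI impI, elim conjE)
  fix s x assume s: "\<forall>n. s n \<in> nclosure S" and x: "x \<in> E" and lim: "(\<lambda>n. N (s n - x)) \<longlonglongrightarrow> 0"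
  have sE: "s n \<in> E" for n using s by (auto simp: nclosure_def)
  have "\<exists>v\<in>S. N (v - s n) < 1 / real (Suc n)" for n
  proof -
    obtain t where t: "\<And>k. t k \<in> S" "(\<lambda>k. N (t k - s n)) \<longlonglongrightarrow> 0"
      using s by (auto simp: nclosure_def)
    have "\<forall>\<^sub>F k in sequentially. N (t k - s n) < 1 / real (Suc n)"
      by (rule order_tendstoD(2)[OF t(2)]) simp
    then show ?thesis using t(1) by (auto simp: eventually_sequentially)
  qed
  then obtain v where v: "\<And>n. v n \<in> S" "\<And>n. N (v n - s n) < 1 / real (Suc n)" by metis
  have "(\<lambda>n. N (v n - x)) \<longlonglongrightarrow> 0"
  proof (rule tendsto_sandwich[OF _ _ tendsto_const])
    have "N (v n - x) \<le> C * (1 / real (Suc n) + N (s n - x))" for n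
    proof -
      have "N (v n - x) \<le> C * (N (v n - s n) + N (s n - x))"
        using N_add[of "v n - s n" "s n - x"] v(1) S sE x E_simps by (simp add: subset_iff)
      also have "\<dots> \<le> C * (1 / real (Suc n) + N (s n - x))"
        using v(2)[of n] C_pos by (intro mult_left_mono add_right_mono) auto
      finally show ?thesis .
    qed
    then show "\<forall>\<^sub>F n in sequentially. N (v n - x) \<le> C * (1 / real (Suc n) + N (s n - x))" by simp
    have "(\<lambda>n. C * (1 / real (Suc n) + N (s n - x))) \<longlonglongrightarrow> C * (0 + 0)"
      by (intro tendsto_intros lim LIMSEQ_Suc lim_1_over_n)
    then show "(\<lambda>n. C * (1 / real (Suc n) + N (s n - x))) \<longlonglongrightarrow> 0" by simp
    show "\<forall>\<^sub>F n in sequentially. 0 \<le> N (v n - x)"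
      using v(1) S x by (intro always_eventually allI N_nonneg E_simps) auto
  qed
  then show "x \<in> nclosure S" using v(1) x by (auto simp: nclosure_def)
qed

lemma span_range_lepoll_real:
  fixes u :: "nat \<Rightarrow> 'v"
  shows "span (range u) \<lesssim> (UNIV :: real set)"
proof -
  have "\<exists>(n::nat) a. v = (\<Sum>i<n. a i \<odot> u i)" if v: "v \<in> span (range u)" for v
    using v
  proof (induction rule: span_induct_alt)
    case base
    then show ?case by (intro exI[of _ 0]) simp
  next
    case (step c x y)
    then obtain k n a where x: "x = u k" and y: "y = (\<Sum>i<n. a i \<odot> u i)" by blast
    \<comment> \<open>Both summands are padded with zero coefficients to the common length
      \<open>max (Suc k) n\<close>.\<close>
    have y': "y = (\<Sum>i<max (Suc k) n. (if i < n then a i else 0) \<odot> u i)"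
      unfolding y by (rule sum.mono_neutral_cong_left) auto
    have x': "c \<odot> x = (\<Sum>i<max (Suc k) n. (if i = k then c else 0) \<odot> u i)"
      unfolding x by (simp add: if_distrib[of "\<lambda>b. b \<odot> _"] sum.delta less_max_iff_disj cong: if_cong)
    have "c \<odot> x + y = (\<Sum>i<max (Suc k) n. ((if i = k then c else 0) + (if i < n then a i else 0)) \<odot> u i)"
      unfolding x' y' scale_left_distrib sum.distrib ..
    then show ?case by (intro exI)
  qed
  then have "span (range u) \<subseteq> (\<lambda>(n, a). \<Sum>i<n. a i \<odot> u i) ` (UNIV :: (nat \<times> (nat \<Rightarrow> 'k)) set)"
    by (force simp: image_iff)
  then have "span (range u) \<lesssim> (UNIV :: (nat \<times> (nat \<Rightarrow> 'k)) set)" by (rule subset_image_lepoll)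
  also have "\<dots> \<lesssim> (UNIV :: (nat \<Rightarrow> 'k) set)"
  proof -
    \<comment> \<open>The length is stored as a scalar in front of the coefficients;
      \<open>of_nat\<close> is injective in characteristic 0.\<close>
    have "inj (\<lambda>(n::nat, a :: nat \<Rightarrow> 'k) k. case k of 0 \<Rightarrow> of_nat n | Suc k \<Rightarrow> a k)"
      by (rule injI) (auto simp: fun_eq_iff split: nat.splits)
    then show ?thesis by (auto simp: lepoll_def)
  qed
  also have "\<dots> \<lesssim> (UNIV :: real set)"
    by (intro sequences_lepoll_real real_normed_field_lepoll_real)
  finally show ?thesis .
qed

text \<open>The independent family of \<open>continuum_independent_family\<close> lies in
  \<open>W\<close>, being made of limits of elements of the span. Extending it to a basis gives the
  lower bound; the upper bound already holds for \<open>W\<close> as a set.\<close>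

theorem closed_subspace_dim_continuum:
  fixes u :: "nat \<Rightarrow> 'v"
  assumes u: "\<And>n. u n \<in> E" "\<And>n. u n \<notin> span (u ` {..<n})"
  defines "W \<equiv> nclosure (span (range u))"
  shows "subspace W" "nclosed W" "range u \<subseteq> W"
    "\<exists>B. B \<subseteq> W \<and> independent B \<and> span B = W \<and> B \<approx> (UNIV :: real set)"
proof -
  have sE: "span (range u) \<subseteq> E" using u(1) by (intro span_subset_E) auto
  show sub: "subspace W" unfolding W_def by (intro subspace_nclosure sE subspace_span)
  show "nclosed W" unfolding W_def by (intro nclosed_nclosure sE)
  show "range u \<subseteq> W" unfolding W_def using nclosure_superset[OF sE] span_superset by blast
  obtain e \<delta> where e: "\<And>n. e n \<in> span (range u)" "\<And>n. \<delta> n > 0"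
    "\<And>n a m. m \<in> span (e ` {..<n}) \<Longrightarrow> norm a * \<delta> n \<le> N (m + a \<odot> e n)"
    "\<And>n. N (e (Suc n)) \<le> \<eta> * \<delta> n"
    using rapidly_decreasing_sequence[OF u] by metis
  have eE: "e n \<in> E" for n using e(1) sE by blast
  obtain w :: "nat set \<Rightarrow> 'v" where w: "inj w" "independent (range w)" "\<And>S. w S \<in> E"
    "\<And>S. \<exists>d. (\<lambda>n. N ((\<Sum>j<n. d j \<odot> e j) - w S)) \<longlonglongrightarrow> 0"
    using continuum_independent_family[of e \<delta>, OF eE e(2) e(3) e(4)] by blast
  have "w S \<in> W" for S
  proof -
    obtain d where "(\<lambda>n. N ((\<Sum>j<n. d j \<odot> e j) - w S)) \<longlonglongrightarrow> 0" using w(4) by blast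
    moreover have "(\<Sum>j<n. d j \<odot> e j) \<in> span (range u)" for n
      using e(1) by (intro span_sum span_scale)
    ultimately show ?thesis unfolding W_def nclosure_def using w(3)[of S]
      by (intro CollectI conjI exI[of _ "\<lambda>n. \<Sum>j<n. d j \<odot> e j"]) auto
  qed
  then obtain B where B: "range w \<subseteq> B" "B \<subseteq> W" "independent B" "W \<subseteq> span B"
    using maximal_independent_subset_extend[OF _ w(2), of W] by blast
  have "W \<lesssim> (UNIV :: real set)"
  proof -
    obtain g :: "'v \<Rightarrow> real" where g: "inj_on g (span (range u))"
      using span_range_lepoll_real[of u] by (auto simp: lepoll_def)
    have "\<forall>w\<in>W. \<exists>s. (\<forall>n. s n \<in> span (range u)) \<and> (\<lambda>n. N (s n - w)) \<longlonglongrightarrow> 0"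
      by (auto simp: W_def nclosure_def)
    then obtain s where s: "\<And>w n. w \<in> W \<Longrightarrow> s w n \<in> span (range u)"
      "\<And>w. w \<in> W \<Longrightarrow> (\<lambda>n. N (s w n - w)) \<longlonglongrightarrow> 0"
      by metis
    \<comment> \<open>Limits are unique, so a point is determined by the sequence chosen to
      approximate it, and \<open>g\<close> codes the terms of that sequence by reals.\<close>
    have "inj_on (\<lambda>w n. g (s w n)) W"
    proof (rule inj_onI)
      fix x y assume xy: "x \<in> W" "y \<in> W" "(\<lambda>n. g (s x n)) = (\<lambda>n. g (s y n))"
      then have "s x n = s y n" for n using g s(1) by (metis inj_onD)
      then have "s x = s y" by blast
      then have "(\<lambda>n. N (s x n - y)) \<longlonglongrightarrow> 0" using s(2)[OF xy(2)] by simp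
      then show "x = y" using s(1)[OF xy(1)] s(2)[OF xy(1)] xy(1,2) sE
        by (intro limit_unique[of "s x"]) (auto simp: W_def nclosure_def)
    qed
    then have "W \<lesssim> (UNIV :: (nat \<Rightarrow> real) set)" by (auto simp: lepoll_def)
    then show ?thesis using sequences_lepoll_real[OF lepoll_refl] lepoll_trans by blast
  qed
  then have "B \<lesssim> (UNIV :: real set)" using B(2) subset_imp_lepoll lepoll_trans by blast
  moreover have "(UNIV :: real set) \<lesssim> B"
  proof -
    have "(UNIV :: nat set set) \<lesssim> B" using w(1) B(1) by (auto simp: lepoll_def)
    then show ?thesis using nat_sets_eqpoll_reals eqpoll_sym lepoll_trans1 by blast
  qed
  ultimately have "B \<approx> (UNIV :: real set)" by (rule lepoll_antisym)
  moreover have "span B = W" using B sub by (intro span_subspace)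
  ultimately show "\<exists>B. B \<subseteq> W \<and> independent B \<and> span B = W \<and> B \<approx> (UNIV :: real set)"
    using B by blast
qed

end

section \<open>Invariant sequence spaces\<close>

lemma kbanach_vector_space_seqscale:
  assumes "kbanach smul"
  shows "vector_space (seqscale smul)"
  using assms by unfold_locales (auto simp: kbanach_def seqscale_def fun_eq_iff)

lemma kbanach_simps:
  assumes "kbanach smul"
  shows "smul a (x + y) = smul a x + smul a y" "smul (a + b) x = smul a x + smul b x"
    "smul a (smul b x) = smul (a * b) x" "smul 1 x = x" "norm (smul a x) = norm a * norm x"
  using assms by (auto simp: kbanach_def)

lemma kbanach_smul_eq_0_iff:
  assumes "kbanach smul"
  shows "smul a x = 0 \<longleftrightarrow> a = 0 \<or> x = 0"
  using kbanach_simps(5)[OF assms, of a x] by (metis mult_eq_0_iff norm_eq_zero)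

lemma kbanach_smul_diff:
  assumes "kbanach smul"
  shows "smul (a - b) x = smul a x - smul b x"
  using kbanach_simps(2)[OF assms, of "a - b" b x] by simp

lemma kbanach_tendsto_smul:
  assumes k: "kbanach smul" and a: "a \<longlonglongrightarrow> b"
  shows "(\<lambda>n. smul (a n) x) \<longlonglongrightarrow> smul b x"
proof -
  have "(\<lambda>n. norm (a n - b) * norm x) \<longlonglongrightarrow> 0 * norm x"
    by (intro tendsto_intros tendsto_norm_zero LIM_zero a)
  then have "(\<lambda>n. norm (smul (a n) x - smul b x)) \<longlonglongrightarrow> 0"
    by (simp add: kbanach_smul_diff[OF k, symmetric] kbanach_simps(5)[OF k])
  then show ?thesis by (rule LIM_zero_cancel[OF tendsto_norm_zero_cancel])
qed

text \<open>Multiplying scalars into \<open>x\<close> scales distances by \<open>norm x\<close>,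
  which is positive, so the scalars form a Cauchy sequence in a complete field.\<close>

lemma kbanach_smul_convergent:
  fixes smul :: "'k::{real_normed_field,banach} \<Rightarrow> 'z::banach \<Rightarrow> 'z"
  assumes k: "kbanach smul" and lim: "(\<lambda>n. smul (a n) x) \<longlonglongrightarrow> w" and x: "x \<noteq> 0"
  obtains b where "a \<longlonglongrightarrow> b"
proof -
  have "Cauchy a"
  proof (rule metric_CauchyI)
    fix e :: real assume e: "e > 0"
    have "Cauchy (\<lambda>n. smul (a n) x)" using lim by (rule LIMSEQ_imp_Cauchy)
    moreover have "e * norm x > 0" using e x by simp
    ultimately obtain M where M: "\<And>m n. m \<ge> M \<Longrightarrow> n \<ge> M \<Longrightarrow> dist (smul (a m) x) (smul (a n) x) < e * norm x"
      by (meson metric_CauchyD)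
    have "dist (a m) (a n) < e" if "m \<ge> M" "n \<ge> M" for m n
      using M[OF that] x by (simp add: dist_norm kbanach_smul_diff[OF k, symmetric] kbanach_simps(5)[OF k])
    then show "\<exists>M. \<forall>m\<ge>M. \<forall>n\<ge>M. dist (a m) (a n) < e" by blast
  qed
  then show ?thesis using that Cauchy_convergent convergent_def by blast
qed

lemma lin_subspace_iff_subspace:
  assumes "kbanach smul"
  shows "lin_subspace smul W \<longleftrightarrow> module.subspace (seqscale smul) W"
proof -
  interpret vector_space "seqscale smul" by (rule kbanach_vector_space_seqscale[OF assms])
  show ?thesis unfolding lin_subspace_def subspace_def by blast
qed

lemma quasi_banach_seq_subspace:
  fixes smul :: "'k::{real_normed_field,banach} \<Rightarrow> 'z::banach \<Rightarrow> 'z"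
  assumes k: "kbanach smul" and q: "quasi_banach_seq smul E N"
  obtains C where "quasi_banach_subspace (seqscale smul) E N C"
proof -
  interpret vector_space "seqscale smul" by (rule kbanach_vector_space_seqscale[OF k])
  have E: "lin_subspace smul E"
    and nonneg: "\<forall>x\<in>E. N x \<ge> 0 \<and> (N x = 0 \<longleftrightarrow> x = 0)"
    and hom: "\<forall>a. \<forall>x\<in>E. N (seqscale smul a x) = norm a * N x"
    and quasi: "\<exists>C\<ge>1. \<forall>x\<in>E. \<forall>y\<in>E. N (x + y) \<le> C * (N x + N y)"
    and complete: "\<forall>s. (\<forall>n. s n \<in> E) \<and> (\<forall>\<epsilon>>0. \<exists>M. \<forall>m\<ge>M. \<forall>n\<ge>M. N (s m - s n) < \<epsilon>)
      \<longrightarrow> (\<exists>x\<in>E. (\<lambda>n. N (s n - x)) \<longlonglongrightarrow> 0)"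
    using q unfolding quasi_banach_seq_def by - (elim conjE, assumption)+
  from quasi obtain C where C: "C \<ge> 1" "\<forall>x\<in>E. \<forall>y\<in>E. N (x + y) \<le> C * (N x + N y)" by (elim exE conjE)
  have "quasi_banach_subspace (seqscale smul) E N C"
  proof
    show "subspace E" using E lin_subspace_iff_subspace[OF k] by simp
    fix s :: "nat \<Rightarrow> nat \<Rightarrow> 'z"
    assume "\<And>n. s n \<in> E" "\<And>\<epsilon>. \<epsilon> > 0 \<Longrightarrow> \<exists>M. \<forall>m\<ge>M. \<forall>n\<ge>M. N (s m - s n) < \<epsilon>"
    then show "\<exists>x\<in>E. (\<lambda>n. N (s n - x)) \<longlonglongrightarrow> 0"
      by (intro complete[rule_format]) simp
  next
    show "N (x + y) \<le> C * (N x + N y)" if "x \<in> E" "y \<in> E" for x y using C(2) that by (elim ballE) auto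
  qed (use nonneg hom C(1) in simp_all)
  then show ?thesis by (rule that)
qed

text \<open>Each coordinate is dominated by \<open>N\<close>, so convergence in \<open>E\<close>
  implies coordinatewise convergence. The last clause records this; from it the shape of the
  elements of the closure is found later.\<close>

lemma inv_seq_space_dim_continuum_subspace:
  fixes smul :: "'k::{real_normed_field,banach} \<Rightarrow> 'z::banach \<Rightarrow> 'z"
  assumes E: "inv_seq_space smul E N"
    and u: "\<And>n. u n \<in> E" "\<And>n::nat. u n \<notin> module.span (seqscale smul) (u ` {..<n})"
  obtains W where "W \<subseteq> E" "lin_subspace smul W" "seq_closed_in E N W" "dim_continuum smul W"
    "range u \<subseteq> W"
    "\<And>w. w \<in> W \<Longrightarrow> \<exists>s. (\<forall>n. s n \<in> module.span (seqscale smul) (range u)) \<and> (\<forall>j. (\<lambda>n. s n j) \<longlonglongrightarrow> w j)"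
proof -
  have k: "kbanach smul" and q: "quasi_banach_seq smul E N"
    and coord: "\<And>x j. x \<in> E \<Longrightarrow> norm (x j) \<le> N x"
    using E by (auto simp: inv_seq_space_def)
  obtain C where "quasi_banach_subspace (seqscale smul) E N C" using quasi_banach_seq_subspace[OF k q] .
  then interpret quasi_banach_subspace "seqscale smul" E N C .
  define W where "W = nclosure (span (range u))"
  have sE: "span (range u) \<subseteq> E" using u(1) by (intro span_subset_E) auto
  show ?thesis
  proof (rule that[of W])
    note * = closed_subspace_dim_continuum[OF u, folded W_def]
    show "W \<subseteq> E" by (auto simp: W_def nclosure_def)
    show "lin_subspace smul W" using *(1) lin_subspace_iff_subspace[OF k] by simp
    show "seq_closed_in E N W" using *(2) by (simp add: nclosed_def seq_closed_in_def)
    show "range u \<subseteq> W" by (rule *(3))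
    show "dim_continuum smul W" using *(4) unfolding dim_continuum_def by blast
    fix w assume "w \<in> W"
    then obtain s where s: "\<And>n. s n \<in> span (range u)" "w \<in> E" "(\<lambda>n. N (s n - w)) \<longlonglongrightarrow> 0"
      unfolding W_def nclosure_def by blast
    have "(\<lambda>n. s n j) \<longlonglongrightarrow> w j" for j
    proof -
      have "norm (s n j - w j) \<le> N (s n - w)" for n
        using coord[of "s n - w" j] s(1,2) sE E_simps(2)[of "s n" w] by auto
      then have "(\<lambda>n. s n j - w j) \<longlonglongrightarrow> 0"
        by (intro Lim_null_comparison[OF _ s(3)]) auto
      then show ?thesis by (rule LIM_zero_cancel)
    qed
    then show "\<exists>s. (\<forall>n. s n \<in> span (range u)) \<and> (\<forall>j. (\<lambda>n. s n j) \<longlonglongrightarrow> w j)" using s(1) by blast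
  qed
qed

text \<open>A greedy choice, possible since no finite set spans \<open>E\<close>. The alternative
  \<open>x = 0\<close> remains because the zero vector cannot belong to an independent
  sequence.\<close>

lemma inv_seq_space_independent_sequence:
  fixes smul :: "'k::{real_normed_field,banach} \<Rightarrow> 'z::banach \<Rightarrow> 'z"
  assumes E: "inv_seq_space smul E N" and x: "x \<in> E"
  obtains u :: "nat \<Rightarrow> nat \<Rightarrow> 'z" where "\<And>n. u n \<in> E"
    "\<And>n. u n \<notin> module.span (seqscale smul) (u ` {..<n})" "x = u 0 \<or> x = 0"
proof -
  have k: "kbanach smul" and q: "quasi_banach_seq smul E N" and inf: "infinite_dim smul E"
    using E by (auto simp: inv_seq_space_def)
  interpret vector_space "seqscale smul" by (rule kbanach_vector_space_seqscale[OF k])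
  have sub: "subspace E" using q lin_subspace_iff_subspace[OF k] by (simp add: quasi_banach_seq_def)
  have "\<exists>v\<in>E. v \<notin> span S" if "finite S" "S \<subseteq> E" for S
    using inf that span_minimal[OF that(2) sub] unfolding infinite_dim_def by blast
  then obtain v where v: "\<And>S. finite S \<Longrightarrow> S \<subseteq> E \<Longrightarrow> v S \<in> E \<and> v S \<notin> span S" by metis
  define p where "p S = (if S = {} \<and> x \<noteq> 0 then x else v S)" for S
  have p: "p S \<in> E \<and> p S \<notin> span S" if "finite S" "S \<subseteq> E" for S
    using v[OF that] x by (auto simp: p_def)
  \<comment> \<open>\<open>A n\<close> collects the vectors chosen in the first \<open>n\<close>
    steps.\<close>
  define A where "A = rec_nat {} (\<lambda>_ S. insert (p S) S)"
  have A0: "A 0 = {}" and AS: "A (Suc n) = insert (p (A n)) (A n)" for n by (simp_all add: A_def)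
  have A_im: "A n = (\<lambda>i. p (A i)) ` {..<n}" for n
    by (induction n) (auto simp: A0 AS lessThan_Suc)
  have A: "finite (A n) \<and> A n \<subseteq> E" for n by (induction n) (auto simp: A0 AS p)
  show ?thesis
  proof (rule that[of "\<lambda>n. p (A n)"])
    show "p (A n) \<in> E" for n using p A by blast
    show "p (A n) \<notin> span ((\<lambda>i. p (A i)) ` {..<n})" for n
      using p[of "A n"] A[of n] by (simp add: A_im[symmetric])
    show "x = p (A 0) \<or> x = 0" by (simp add: A0 p_def)
  qed
qed

section \<open>Zero-free versions and compression to an infinite set\<close>

lemma strict_mono_range_eq:
  fixes f g :: "nat \<Rightarrow> nat"
  assumes f: "strict_mono f" and g: "strict_mono g" and eq: "range f = range g"
  shows "f = g"
proof
  fix n show "f n = g n"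
  proof (induction n rule: less_induct)
    case (less n)
    \<comment> \<open>The value \<open>h n\<close> is some \<open>h' m\<close>. If
      \<open>m < n\<close>, then \<open>h n = h m\<close>, against strictness; so
      \<open>h' n\<close> is at most \<open>h n\<close>. Using this in both directions gives
      equality.\<close>
    have le: "h' n \<le> h n" if hh: "strict_mono h" "strict_mono h'" "range h = range h'" "\<And>m. m < n \<Longrightarrow> h m = h' m"
      for h h' :: "nat \<Rightarrow> nat"
    proof -
      obtain m where m: "h n = h' m" using hh(3) by (metis rangeI imageE)
      have "\<not> m < n" using m hh(1,4) by (metis less_irrefl strict_mono_less)
      then show ?thesis using m hh(2) by (simp add: strict_mono_less_eq)
    qed
    show ?case using le[OF f g eq] le[OF g f eq[symmetric]] less.IH by (simp add: order_antisym)
  qed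
qed

lemma enumerate_range:
  fixes f :: "nat \<Rightarrow> nat"
  assumes "strict_mono f"
  shows "enumerate (range f) = f"
proof (rule strict_mono_range_eq[OF _ assms])
  have "infinite (range f)" using assms by (simp add: range_inj_infinite strict_mono_imp_inj_on)
  then show "strict_mono (enumerate (range f))" "range (enumerate (range f)) = range f"
    by (rule strict_mono_enumerate, rule range_enumerate)
qed

lemma zero_free_eq_0_iff: "zero_free x = 0 \<longleftrightarrow> finite {j. x j \<noteq> 0}"
proof -
  have "zero_free x 0 \<noteq> 0" if "infinite {j. x j \<noteq> 0}"
    using enumerate_in_set[OF that, of 0] that by (simp add: zero_free_def)
  then show ?thesis by (auto simp: zero_free_def fun_eq_iff)
qed

lemma zero_free_nonzero: "infinite {j. x j \<noteq> 0} \<Longrightarrow> zero_free x k \<noteq> 0"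
  using enumerate_in_set[of "{j. x j \<noteq> 0}" k] by (simp add: zero_free_def)

text \<open>The two enumerations compose to an increasing map onto the support of \<open>v\<close>,
  and an increasing map is determined by its range.\<close>

lemma zero_free_compress:
  assumes B: "infinite B" and off: "\<And>j. j \<notin> B \<Longrightarrow> v j = 0"
  shows "zero_free v = zero_free (v \<circ> enumerate B)"
proof -
  let ?S = "{j. v j \<noteq> 0}" and ?T = "{k. (v \<circ> enumerate B) k \<noteq> 0}"
  have ST: "?S = enumerate B ` ?T" using off range_enumerate[OF B] by (force simp: image_iff)
  have inj: "inj (enumerate B)" using B strict_mono_enumerate strict_mono_imp_inj_on by blast
  have fin: "finite ?S \<longleftrightarrow> finite ?T"
    unfolding ST by (rule finite_image_iff) (rule inj_on_subset[OF inj], simp)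
  show ?thesis
  proof (cases "finite ?T")
    case False
    have "?S = range (enumerate B \<circ> enumerate ?T)"
      unfolding ST image_comp[symmetric] range_enumerate[OF False] ..
    then have "enumerate ?S = enumerate B \<circ> enumerate ?T"
      by (simp only: enumerate_range[OF strict_mono_o[OF strict_mono_enumerate[OF B] strict_mono_enumerate[OF False]]])
    then show ?thesis using fin False by (simp add: zero_free_def)
  qed (use fin in \<open>simp add: zero_free_def\<close>)
qed

lemma zero_free_no_zeros:
  assumes "\<And>k. v k \<noteq> 0"
  shows "zero_free v = v"
proof -
  have "enumerate UNIV = (id :: nat \<Rightarrow> nat)" using enumerate_range[of "id :: nat \<Rightarrow> nat"] by (simp add: strict_mono_id)
  then show ?thesis using assms by (simp add: zero_free_def)
qed

lemma inv_seq_space_zero_free_cong: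
  assumes "inv_seq_space smul E N" "zero_free v = zero_free w" "zero_free v \<noteq> 0"
  shows "v \<in> E \<longleftrightarrow> w \<in> E"
  using assms unfolding inv_seq_space_def by metis

lemma strongly_inv_seq_spaceD:
  assumes "strongly_inv_seq_space smul F N"
  shows "inv_seq_space smul F N" "c00 \<subseteq> F" "strict_mono \<sigma> \<Longrightarrow> v \<in> F \<Longrightarrow> v \<circ> \<sigma> \<in> F"
proof -
  note * = assms[unfolded strongly_inv_seq_space_def]
  show "inv_seq_space smul F N" using * by (rule conjunct1)
  show "c00 \<subseteq> F" using * by (elim conjE)
  assume "strict_mono \<sigma>" "v \<in> F"
  from * have "\<forall>x. x \<in> F \<longleftrightarrow> (\<forall>\<sigma>::nat\<Rightarrow>nat. strict_mono \<sigma> \<longrightarrow> x \<circ> \<sigma> \<in> F)" by (elim conjE)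
  from spec[OF this, of v] show "v \<circ> \<sigma> \<in> F" using \<open>strict_mono \<sigma>\<close> \<open>v \<in> F\<close> by simp
qed

text \<open>Invariance under passing to zero-free versions covers infinite supports; for finite
  supports both sides hold by \<open>c00 \<subseteq> F\<close>.\<close>

lemma strongly_inv_seq_space_compress:
  assumes F: "strongly_inv_seq_space smul F N" and B: "infinite B" and off: "\<And>j. j \<notin> B \<Longrightarrow> v j = 0"
  shows "v \<in> F \<longleftrightarrow> v \<circ> enumerate B \<in> F"
proof -
  have eq: "zero_free v = zero_free (v \<circ> enumerate B)" using B off by (rule zero_free_compress)
  show ?thesis
  proof (cases "zero_free v = 0")
    case True
    then have "v \<in> c00" "v \<circ> enumerate B \<in> c00"
      using eq by (simp_all only: c00_def mem_Collect_eq flip: zero_free_eq_0_iff)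
    then show ?thesis using strongly_inv_seq_spaceD(2)[OF F] by blast
  next
    case False
    then show ?thesis by (rule inv_seq_space_zero_free_cong[OF strongly_inv_seq_spaceD(1)[OF F] eq])
  qed
qed

section \<open>Splitting index sets into infinite blocks\<close>

text \<open>The set \<open>C\<close> is enumerated by pairs of naturals, and \<open>idx\<close>
  returns the first component.\<close>

lemma infinite_fibres:
  fixes C :: "nat set"
  assumes "infinite C"
  obtains idx :: "nat \<Rightarrow> nat" where "\<And>i. infinite {j \<in> C. idx j = i}"
proof (rule that)
  fix i
  let ?idx = "\<lambda>j. fst (prod_decode (inv (enumerate C) j))"
  have inj: "inj (enumerate C)" using strict_mono_enumerate[OF assms] strict_mono_imp_inj_on by blast
  then have "range (\<lambda>k. enumerate C (prod_encode (i, k))) \<subseteq> {j \<in> C. ?idx j = i}"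
    using enumerate_in_set[OF assms] by auto
  moreover have "inj (\<lambda>k. enumerate C (prod_encode (i, k)))"
    by (rule injI) (auto dest: injD[OF inj])
  ultimately show "infinite {j \<in> C. ?idx j = i}"
    using range_inj_infinite finite_subset by blast
qed

lemma fibrewise_copies:
  fixes idx :: "nat \<Rightarrow> nat"
  assumes inf: "\<And>i. infinite {j \<in> C. idx j = i}"
  obtains y :: "nat \<Rightarrow> 'a::zero"
  where "\<And>i. y \<circ> enumerate {j \<in> C. idx j = i} = z" "\<And>j. j \<notin> C \<Longrightarrow> y j = 0"
proof
  \<comment> \<open>The inverse enumeration gives the rank of \<open>j\<close> inside its own
    block.\<close>
  define y where "y j = (if j \<in> C then z (inv (enumerate {j' \<in> C. idx j' = idx j}) j) else 0)" for j
  show "y j = 0" if "j \<notin> C" for j using that by (simp add: y_def)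
  show "y \<circ> enumerate {j \<in> C. idx j = i} = z" for i
  proof
    fix k
    have "inj (enumerate {j \<in> C. idx j = i})"
      using strict_mono_enumerate[OF inf] strict_mono_imp_inj_on by blast
    then show "(y \<circ> enumerate {j \<in> C. idx j = i}) k = z k"
      using enumerate_in_set[OF inf, of i k] by (simp add: y_def)
  qed
qed

text \<open>The second piece is enlarged to \<open>S - A\<close>, so that the pieces exhaust
  \<open>S\<close> as \<open>outside_split\<close> requires.\<close>

lemma infinite_split_Un:
  assumes "infinite (S :: 'a set)"
  obtains A B where "infinite A" "infinite B" "A \<inter> B = {}" "S = A \<union> B"
proof -
  obtain A B where "A \<subseteq> S" "B \<subseteq> S" "infinite A" "infinite B" "A \<inter> B = {}"
    using infinite_split[OF assms] by blast
  moreover have "B \<subseteq> S - A" using calculation by blast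
  ultimately show ?thesis using that[of A "S - A"] finite_subset[of B "S - A"] by blast
qed

section \<open>Sequences whose image escapes every weak space\<close>

text \<open>The index set is nonempty here: over an empty one every sequence would be
  \<open>outside\<close>, even those of finite support.\<close>

locale compatible_family =
  fixes smulX :: "'k::{real_normed_field,banach} \<Rightarrow> 'x::banach \<Rightarrow> 'x"
    and smulY :: "'k \<Rightarrow> 'y::banach \<Rightarrow> 'y"
    and \<Gamma> :: "'i set" and F :: "'i \<Rightarrow> (nat \<Rightarrow> 'k) set" and NF :: "'i \<Rightarrow> (nat \<Rightarrow> 'k) \<Rightarrow> real"
    and f :: "'x \<Rightarrow> 'y"
  assumes F: "l \<in> \<Gamma> \<Longrightarrow> strongly_inv_seq_space (*) (F l) (NF l)"
    and f: "l \<in> \<Gamma> \<Longrightarrow> strongly_compatible smulX smulY f (F l)"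
    and nested: "nested \<Gamma> (\<lambda>l. weak_seq smulY (F l))"
    and \<Gamma>_nonempty: "\<Gamma> \<noteq> {}"
begin

text \<open>Membership in \<open>E\<close> is left out because the argument passes to subsequences
  for which it is not asserted.\<close>

definition outside :: "(nat \<Rightarrow> 'x) \<Rightarrow> bool" where
  "outside z \<longleftrightarrow> (\<forall>l\<in>\<Gamma>. \<exists>\<phi>\<in>kdual smulY. (\<lambda>j. \<phi> (f (z j))) \<notin> F l)"

lemma Gw_iff: "z \<in> Gw smulY E f \<Gamma> F \<longleftrightarrow> z \<in> E \<and> outside z"
  by (auto simp: Gw_def outside_def weak_seq_def)

lemma f_0: "f 0 = 0"
  using f \<Gamma>_nonempty by (auto simp: strongly_compatible_def)

lemma kdual_0: "\<phi> \<in> kdual smulY \<Longrightarrow> \<phi> 0 = 0"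
  by (simp add: kdual_def linear_simps)

text \<open>Strongly invariant spaces contain the subsequences of their members, so escaping along a
  subsequence suffices.\<close>

lemma outside_subseq:
  assumes "strict_mono \<sigma>" "outside (z \<circ> \<sigma>)"
  shows "outside z"
  unfolding outside_def
proof
  fix l assume l: "l \<in> \<Gamma>"
  then obtain \<phi> where \<phi>: "\<phi> \<in> kdual smulY" "(\<lambda>j. \<phi> (f (z j))) \<circ> \<sigma> \<notin> F l"
    using assms(2) by (auto simp: outside_def o_def)
  then show "\<exists>\<phi>\<in>kdual smulY. (\<lambda>j. \<phi> (f (z j))) \<notin> F l"
    using strongly_inv_seq_spaceD(3)[OF F[OF l] assms(1)] by blast
qed

lemma outside_compress:
  assumes B: "infinite B" and off: "\<And>j. j \<notin> B \<Longrightarrow> z j = 0"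
  shows "outside z \<longleftrightarrow> outside (z \<circ> enumerate B)"
proof -
  have "(\<lambda>j. \<phi> (f (z j))) \<in> F l \<longleftrightarrow> (\<lambda>j. \<phi> (f ((z \<circ> enumerate B) j))) \<in> F l"
    if "l \<in> \<Gamma>" "\<phi> \<in> kdual smulY" for l \<phi>
  proof -
    have "(\<lambda>j. \<phi> (f (z j))) \<in> F l \<longleftrightarrow> (\<lambda>j. \<phi> (f (z j))) \<circ> enumerate B \<in> F l"
      using off f_0 kdual_0[OF that(2)] by (intro strongly_inv_seq_space_compress[OF F[OF that(1)] B]) simp
    then show ?thesis by (simp add: o_def)
  qed
  then show ?thesis unfolding outside_def by blast
qed

lemma outside_scale:
  assumes "a \<noteq> 0" "outside z"
  shows "outside (\<lambda>j. smulX a (z j))"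
  unfolding outside_def
proof
  fix l assume l: "l \<in> \<Gamma>"
  then obtain \<phi> where \<phi>: "\<phi> \<in> kdual smulY" "(\<lambda>j. \<phi> (f (z j))) \<notin> F l"
    using assms(2) by (auto simp: outside_def)
  then have "compatible smulX (\<phi> \<circ> f) (F l)" using f[OF l] by (simp add: strongly_compatible_def)
  then have "(\<lambda>j. (\<phi> \<circ> f) (smulX a (z j))) \<notin> F l"
    using assms(1) \<phi>(2) by (simp add: compatible_def)
  then show "\<exists>\<phi>\<in>kdual smulY. (\<lambda>j. \<phi> (f (smulX a (z j)))) \<notin> F l" using \<phi>(1) by auto
qed

lemma outside_infinite_support:
  assumes "outside z"
  shows "infinite {j. z j \<noteq> 0}"
proof
  assume fin: "finite {j. z j \<noteq> 0}"
  obtain l where l: "l \<in> \<Gamma>" using \<Gamma>_nonempty by blast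
  then obtain \<phi> where \<phi>: "\<phi> \<in> kdual smulY" "(\<lambda>j. \<phi> (f (z j))) \<notin> F l"
    using assms by (auto simp: outside_def)
  have "{j. \<phi> (f (z j)) \<noteq> 0} \<subseteq> {j. z j \<noteq> 0}" using f_0 kdual_0[OF \<phi>(1)] by auto
  then have "(\<lambda>j. \<phi> (f (z j))) \<in> c00" using fin finite_subset by (auto simp: c00_def)
  then show False using \<phi>(2) strongly_inv_seq_spaceD(2)[OF F[OF l]] by blast
qed

lemma outside_zero_free:
  assumes "outside z"
  shows "outside (zero_free z)"
proof -
  have inf: "infinite {j. z j \<noteq> 0}" using assms by (rule outside_infinite_support)
  then have "zero_free z = z \<circ> enumerate {j. z j \<noteq> 0}" by (simp add: zero_free_def o_def)
  moreover have "outside z \<longleftrightarrow> outside (z \<circ> enumerate {j. z j \<noteq> 0})"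
    using inf by (intro outside_compress) auto
  ultimately show ?thesis using assms by simp
qed

text \<open>If both parts failed, nestedness would put their images into one common weak space.
  These images add up to the image of \<open>z\<close> although \<open>f\<close> need not be
  additive: at every position one part is 0, and \<open>f 0 = 0\<close>.\<close>

lemma outside_split:
  assumes z: "outside z" and AB: "A \<inter> B = {}" "{j. z j \<noteq> 0} = A \<union> B"
  shows "outside (\<lambda>j. if j \<in> A then z j else 0) \<or> outside (\<lambda>j. if j \<in> B then z j else 0)"
    (is "outside ?a \<or> outside ?b")
proof (rule ccontr)
  assume "\<not> ?thesis"
  then obtain l m where "l \<in> \<Gamma>" "m \<in> \<Gamma>" "(\<lambda>j. f (?a j)) \<in> weak_seq smulY (F l)"
    "(\<lambda>j. f (?b j)) \<in> weak_seq smulY (F m)"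
    by (auto simp: outside_def weak_seq_def)
  then obtain n where n: "n \<in> \<Gamma>" "(\<lambda>j. f (?a j)) \<in> weak_seq smulY (F n)"
    "(\<lambda>j. f (?b j)) \<in> weak_seq smulY (F n)"
    using nested unfolding nested_def by blast
  obtain \<phi> where \<phi>: "\<phi> \<in> kdual smulY" "(\<lambda>j. \<phi> (f (z j))) \<notin> F n"
    using z n(1) by (auto simp: outside_def)
  have "lin_subspace (*) (F n)"
    using strongly_inv_seq_spaceD(1)[OF F[OF n(1)]] by (simp add: inv_seq_space_def quasi_banach_seq_def)
  moreover have "(\<lambda>j. \<phi> (f (?a j))) \<in> F n" "(\<lambda>j. \<phi> (f (?b j))) \<in> F n"
    using n(2,3) \<phi>(1) by (auto simp: weak_seq_def)
  ultimately have "(\<lambda>j. \<phi> (f (?a j))) + (\<lambda>j. \<phi> (f (?b j))) \<in> F n"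
    unfolding lin_subspace_def by blast
  moreover have "(\<lambda>j. \<phi> (f (?a j))) + (\<lambda>j. \<phi> (f (?b j))) = (\<lambda>j. \<phi> (f (z j)))"
    using AB f_0 kdual_0[OF \<phi>(1)] by (auto simp: fun_eq_iff)
  ultimately show False using \<phi>(2) by simp
qed

text \<open>Whichever half of the support carries an escaping restriction is called
  \<open>B\<close>; the other half is free for the copies.\<close>

lemma outside_subset_of_support:
  assumes z: "outside z"
  obtains B C where "infinite B" "infinite C" "B \<inter> C = {}" "B \<subseteq> {j. z j \<noteq> 0}" "outside (z \<circ> enumerate B)"
proof -
  obtain A B where AB: "infinite A" "infinite B" "A \<inter> B = {}" "{j. z j \<noteq> 0} = A \<union> B"
    using infinite_split_Un[OF outside_infinite_support[OF z]] by blast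
  have restrict: "outside (z \<circ> enumerate S)" if S: "infinite S" "outside (\<lambda>j. if j \<in> S then z j else 0)" for S
  proof -
    have "outside ((\<lambda>j. if j \<in> S then z j else 0) \<circ> enumerate S)"
      using S by (subst outside_compress[symmetric]) auto
    moreover have "(\<lambda>j. if j \<in> S then z j else 0) \<circ> enumerate S = z \<circ> enumerate S"
      using enumerate_in_set[OF S(1)] by (auto simp: fun_eq_iff)
    ultimately show ?thesis by simp
  qed
  from outside_split[OF z AB(3,4)] show ?thesis
  proof
    assume "outside (\<lambda>j. if j \<in> A then z j else 0)"
    then show ?thesis using that[of A B] AB restrict by blast
  next
    assume "outside (\<lambda>j. if j \<in> B then z j else 0)"
    then show ?thesis using that[of B A] AB restrict by blast
  qed
qed

end

text \<open>The map \<open>idx\<close> names the block of each coordinate, and \<open>I\<close> is the set of blocks on which a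
  multiple of \<open>y\<close> may be added. No summability is imposed on the coefficients, so membership is a
  purely coordinatewise condition and passes to coordinatewise limits.\<close>
definition block_combinations ::
  "('k::zero \<Rightarrow> 'x \<Rightarrow> 'x) \<Rightarrow> (nat \<Rightarrow> 'x) \<Rightarrow> (nat \<Rightarrow> 'x) \<Rightarrow> (nat \<Rightarrow> nat) \<Rightarrow> nat set \<Rightarrow> (nat \<Rightarrow> 'x::plus) set" where
  "block_combinations smul x y idx I =
    {w. \<exists>a b. (\<forall>i. i \<notin> I \<longrightarrow> b i = 0)
      \<and> (\<forall>j. w j = smul a (x j) + smul (b (idx j)) (y j))}"

lemma lin_subspace_block_combinations:
  assumes k: "kbanach smul"
  shows "lin_subspace smul (block_combinations smul x y idx I)"
  unfolding lin_subspace_def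
proof (intro conjI ballI allI)
  have "smul 0 z = 0" for z using kbanach_smul_eq_0_iff[OF k] by simp
  then show "0 \<in> block_combinations smul x y idx I"
    by (auto simp: block_combinations_def intro!: exI[of _ 0])
next
  fix v w assume "v \<in> block_combinations smul x y idx I" "w \<in> block_combinations smul x y idx I"
  then obtain a b a' b' where
    "\<And>i. i \<notin> I \<Longrightarrow> b i = 0" "\<And>j. v j = smul a (x j) + smul (b (idx j)) (y j)"
    "\<And>i. i \<notin> I \<Longrightarrow> b' i = 0" "\<And>j. w j = smul a' (x j) + smul (b' (idx j)) (y j)"
    unfolding block_combinations_def by blast
  then show "v + w \<in> block_combinations smul x y idx I"
    unfolding block_combinations_def
    by (intro CollectI exI[of _ "a + a'"] exI[of _ "\<lambda>i. b i + b' i"])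
      (simp add: kbanach_simps(2)[OF k])
next
  fix c v assume "v \<in> block_combinations smul x y idx I"
  then obtain a b where
    "\<And>i. i \<notin> I \<Longrightarrow> b i = 0" "\<And>j. v j = smul a (x j) + smul (b (idx j)) (y j)"
    unfolding block_combinations_def by blast
  then show "seqscale smul c v \<in> block_combinations smul x y idx I"
    unfolding block_combinations_def
    by (intro CollectI exI[of _ "c * a"] exI[of _ "\<lambda>i. c * b i"])
      (simp add: seqscale_def kbanach_simps(1,3)[OF k])
qed

text \<open>Position \<open>p\<close> sees \<open>x\<close> alone, so the coefficients of
  \<open>x\<close> converge. Subtracting their contribution at \<open>q i\<close>, where
  \<open>y\<close> is nonzero, shows that the coefficients of block \<open>i\<close> converge
  too.\<close>

lemma block_combinations_limit:
  fixes smul :: "'k::{real_normed_field,banach} \<Rightarrow> 'x::banach \<Rightarrow> 'x"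
  assumes k: "kbanach smul"
    and p: "x p \<noteq> 0" "y p = 0"
    and q: "\<And>i. idx (q i) = i" "\<And>i. y (q i) \<noteq> 0"
    and s: "\<And>n. s n \<in> block_combinations smul x y idx UNIV"
    and lim: "\<And>j. (\<lambda>n. s n j) \<longlonglongrightarrow> w j"
  shows "w \<in> block_combinations smul x y idx UNIV"
proof -
  from s obtain a b where sab: "\<And>n j. s n j = smul (a n) (x j) + smul (b n (idx j)) (y j)"
    unfolding block_combinations_def by simp metis
  have "smul c 0 = 0" for c using kbanach_smul_eq_0_iff[OF k] by simp
  then have "(\<lambda>n. smul (a n) (x p)) \<longlonglongrightarrow> w p" using lim[of p] by (simp add: sab p(2))
  then obtain a' where a': "a \<longlonglongrightarrow> a'" using kbanach_smul_convergent[OF k _ p(1)] by blast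
  have "\<exists>c. (\<lambda>n. b n i) \<longlonglongrightarrow> c" for i
  proof -
    have "(\<lambda>n. s n (q i) - smul (a n) (x (q i))) \<longlonglongrightarrow> w (q i) - smul a' (x (q i))"
      by (intro tendsto_diff lim kbanach_tendsto_smul[OF k a'])
    then have "(\<lambda>n. smul (b n i) (y (q i))) \<longlonglongrightarrow> w (q i) - smul a' (x (q i))"
      by (simp add: sab q(1))
    then show ?thesis by (rule kbanach_smul_convergent[OF k _ q(2)]) blast
  qed
  then obtain b' where b': "\<And>i. (\<lambda>n. b n i) \<longlonglongrightarrow> b' i" by metis
  have "w j = smul a' (x j) + smul (b' (idx j)) (y j)" for j
  proof (rule LIMSEQ_unique[OF lim])
    show "(\<lambda>n. s n j) \<longlonglongrightarrow> smul a' (x j) + smul (b' (idx j)) (y j)"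
      unfolding sab by (intro tendsto_add kbanach_tendsto_smul[OF k] a' b')
  qed
  then show ?thesis unfolding block_combinations_def by blast
qed

section \<open>Construction of the closed subspace\<close>

lemma (in compatible_family) pointwise_continuum_spaceable:
  assumes k: "kbanach smulX" and E: "inv_seq_space smulX E NE" and x: "x \<in> E" "outside x"
  shows "\<exists>W. W \<subseteq> E \<and> lin_subspace smulX W \<and> seq_closed_in E NE W
        \<and> dim_continuum smulX W \<and> x \<in> W \<and> (\<forall>w\<in>W. w = 0 \<or> outside w)"
proof -
  interpret V: vector_space "seqscale smulX" by (rule kbanach_vector_space_seqscale[OF k])
  obtain B C where B: "infinite B" "infinite C" "B \<inter> C = {}" "B \<subseteq> {j. x j \<noteq> 0}" "outside (x \<circ> enumerate B)"
    using outside_subset_of_support[OF x(2)] .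
  obtain idx :: "nat \<Rightarrow> nat" where idx: "\<And>i. infinite {j \<in> C. idx j = i}"
    using infinite_fibres[OF B(2)] by metis
  obtain y where y: "\<And>i. y \<circ> enumerate {j \<in> C. idx j = i} = zero_free x" "\<And>j. j \<notin> C \<Longrightarrow> y j = 0"
    using fibrewise_copies[OF idx, of "zero_free x"] by metis
  have infx: "infinite {j. x j \<noteq> 0}" using outside_infinite_support[OF x(2)] .
  \<comment> \<open>The test positions for \<open>block_combinations_limit\<close>: \<open>p\<close>
    lies in \<open>B\<close>, where \<open>x\<close> is nonzero and \<open>y\<close> vanishes, and
    \<open>q i\<close> is the first position of block \<open>i\<close>.\<close>
  define p where "p = enumerate B 0"
  define q where "q i = enumerate {j \<in> C. idx j = i} 0" for i
  have "p \<in> B" unfolding p_def by (rule enumerate_in_set[OF B(1)])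
  then have p: "x p \<noteq> 0" "y p = 0" using B(3,4) y(2) by auto
  have q: "idx (q i) = i" "y (q i) \<noteq> 0" for i
    using enumerate_in_set[OF idx, of i 0] fun_cong[OF y(1)[of i], of 0] zero_free_nonzero[OF infx, of 0]
    by (auto simp: q_def)
  have sm0: "smulX a z = 0 \<longleftrightarrow> a = 0 \<or> z = 0" for a z by (rule kbanach_smul_eq_0_iff[OF k])
  then have smz: "smulX 0 z = 0" "smulX a 0 = 0" for a z by simp_all
  have sm1: "smulX 1 z = z" for z by (rule kbanach_simps(4)[OF k])
  \<comment> \<open>The generators: \<open>x\<close> itself, then the copies one block at a time.
    Restricting by \<open>idx\<close> is enough, as \<open>y\<close> vanishes off
    \<open>C\<close>.\<close>
  define u where "u n = (case n of 0 \<Rightarrow> x | Suc i \<Rightarrow> (\<lambda>j. if idx j = i then y j else 0))" for n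
  let ?V = "block_combinations smulX x y idx"
  have V: "V.subspace (?V I)" for I
    using lin_subspace_block_combinations[OF k] lin_subspace_iff_subspace[OF k] by blast
  have u_V: "u n \<in> ?V I" if "\<And>i. n = Suc i \<Longrightarrow> i \<in> I" for n I
  proof (cases n)
    case 0
    then show ?thesis unfolding block_combinations_def
      by (intro CollectI exI[of _ 1] exI[of _ "\<lambda>_. 0"]) (simp add: u_def smz sm1)
  next
    case (Suc i)
    then show ?thesis using that unfolding block_combinations_def
      by (intro CollectI exI[of _ 0] exI[of _ "\<lambda>k. if k = i then 1 else 0"]) (auto simp: u_def smz sm1)
  qed
  \<comment> \<open>Each copy has the same zero-free version as \<open>x\<close>, so invariance of
    \<open>E\<close> puts it into \<open>E\<close>.\<close>
  have u_E: "u n \<in> E" for n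
  proof (cases n)
    case (Suc i)
    let ?C = "{j \<in> C. idx j = i}"
    have "zero_free (u n) = zero_free (u n \<circ> enumerate ?C)"
      using y(2) by (intro zero_free_compress idx) (auto simp: Suc u_def)
    also have "u n \<circ> enumerate ?C = y \<circ> enumerate ?C"
      using enumerate_in_set[OF idx, of i] by (auto simp: fun_eq_iff Suc u_def)
    also have "zero_free \<dots> = zero_free x"
      unfolding y(1) by (rule zero_free_no_zeros) (rule zero_free_nonzero[OF infx])
    finally have "zero_free x = zero_free (u n)" by simp
    moreover have "zero_free x \<noteq> 0" using infx zero_free_eq_0_iff by blast
    ultimately show ?thesis using inv_seq_space_zero_free_cong[OF E] x(1) by blast
  qed (simp add: u_def x)
  have u_indep: "u n \<notin> V.span (u ` {..<n})" for n
  proof (cases n)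
    case 0
    then show ?thesis using p(1) by (auto simp: u_def)
  next
    case (Suc i)
    \<comment> \<open>For \<open>n = Suc i\<close> the predecessors are \<open>x\<close> and the
      copies on blocks below \<open>i\<close>, hence the strict bound.\<close>
    have "V.span (u ` {..<n}) \<subseteq> ?V {..<i}"
      using Suc by (intro V.span_minimal V) (auto intro!: u_V)
    moreover have "u n \<notin> ?V {..<i}"
    proof
      assume "u n \<in> ?V {..<i}"
      then obtain a b where b: "b i = 0" and ab: "\<And>j. u n j = smulX a (x j) + smulX (b (idx j)) (y j)"
        unfolding block_combinations_def by auto
      \<comment> \<open>At \<open>p\<close> both \<open>u n\<close> and \<open>y\<close> vanish,
        which forces \<open>a = 0\<close>; at \<open>q i\<close> the coefficient is
        \<open>b i = 0\<close>, although \<open>u n\<close> is nonzero there.\<close>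
      have "u n p = 0" using p(2) by (simp add: u_def Suc)
      then have "a = 0" using ab[of p] p by (simp add: smz sm0)
      then show False using ab[of "q i"] q[of i] b by (simp add: u_def Suc smz sm0)
    qed
    ultimately show ?thesis by blast
  qed
  obtain W where W: "W \<subseteq> E" "lin_subspace smulX W" "seq_closed_in E NE W" "dim_continuum smulX W"
    "range u \<subseteq> W"
    "\<And>w. w \<in> W \<Longrightarrow> \<exists>s. (\<forall>n. s n \<in> V.span (range u)) \<and> (\<forall>j. (\<lambda>n. s n j) \<longlonglongrightarrow> w j)"
    using inv_seq_space_dim_continuum_subspace[OF E u_E u_indep] by metis
  have "w = 0 \<or> outside w" if wW: "w \<in> W" for w
  proof -
    obtain s where s: "\<And>n. s n \<in> V.span (range u)" "\<And>j. (\<lambda>n. s n j) \<longlonglongrightarrow> w j"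
      using W(6)[OF wW] by blast
    have "V.span (range u) \<subseteq> ?V UNIV" by (intro V.span_minimal V) (auto intro: u_V)
    then have "\<And>n. s n \<in> ?V UNIV" using s(1) by blast
    from block_combinations_limit[of smulX x p y idx q s w, OF k p q this s(2)]
    have "w \<in> ?V UNIV" .
    then obtain a b where w: "\<And>j. w j = smulX a (x j) + smulX (b (idx j)) (y j)"
      unfolding block_combinations_def by blast
    show ?thesis
    proof (cases "a = 0")
      case False
      \<comment> \<open>On \<open>B\<close> only the multiple of \<open>x\<close> survives, and
        compatibility preserves escaping under nonzero scalars.\<close>
      have "w (enumerate B n) = smulX a (x (enumerate B n))" for n
      proof -
        have "enumerate B n \<notin> C" using enumerate_in_set[OF B(1), of n] B(3) by blast
        then show ?thesis by (simp add: w y(2) smz)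
      qed
      then have "w \<circ> enumerate B = (\<lambda>n. smulX a ((x \<circ> enumerate B) n))" by (simp add: fun_eq_iff)
      then have "outside (w \<circ> enumerate B)" using outside_scale[OF False B(5)] by simp
      then show ?thesis using outside_subseq[OF strict_mono_enumerate[OF B(1)]] by blast
    next
      case True
      show ?thesis
      proof (cases "\<forall>j. b (idx j) = 0")
        case True
        with \<open>a = 0\<close> have "w = 0" by (simp add: fun_eq_iff w smz)
        then show ?thesis ..
      next
        case False
        then obtain i where i: "b i \<noteq> 0" by blast
        let ?C = "{j \<in> C. idx j = i}"
        \<comment> \<open>With \<open>a = 0\<close>, the values of \<open>w\<close> along this block
          are a nonzero multiple of the zero-free version of \<open>x\<close>, which escapes as
          \<open>x\<close> does.\<close>
        have "w (enumerate ?C n) = smulX (b i) ((y \<circ> enumerate ?C) n)" for n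
          using enumerate_in_set[OF idx, of i n] \<open>a = 0\<close> by (simp add: w smz)
        then have "w \<circ> enumerate ?C = (\<lambda>n. smulX (b i) (zero_free x n))"
          unfolding y(1) by (simp add: fun_eq_iff)
        then have "outside (w \<circ> enumerate ?C)"
          using outside_scale[OF i outside_zero_free[OF x(2)]] by simp
        then show ?thesis using outside_subseq[OF strict_mono_enumerate[OF idx]] by blast
      qed
    qed
  qed
  moreover have "x \<in> W" using W(5) by (auto simp: u_def dest!: subsetD[OF _ rangeI[of _ 0]])
  ultimately show ?thesis using W by blast
qed

theorem mainTheorem3:
  fixes smulX :: "'k::{real_normed_field,banach} \<Rightarrow> 'x::banach \<Rightarrow> 'x"
    and smulY :: "'k \<Rightarrow> 'y::banach \<Rightarrow> 'y"
    and E :: "(nat \<Rightarrow> 'x) set" and NE :: "(nat \<Rightarrow> 'x) \<Rightarrow> real"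
    and \<Gamma> :: "'i set" and F :: "'i \<Rightarrow> (nat \<Rightarrow> 'k) set" and NF :: "'i \<Rightarrow> (nat \<Rightarrow> 'k) \<Rightarrow> real"
    and f :: "'x \<Rightarrow> 'y"
  assumes "kbanach smulX" and "kbanach smulY"
    and "inv_seq_space smulX E NE"
    and "\<forall>l\<in>\<Gamma>. strongly_inv_seq_space (*) (F l) (NF l)"
    and "\<forall>l\<in>\<Gamma>. strongly_compatible smulX smulY f (F l)"
    and "nested \<Gamma> (\<lambda>l. weak_seq smulY (F l))"
  shows "Gw smulY E f \<Gamma> F = {} \<or>
    (\<forall>x\<in>Gw smulY E f \<Gamma> F. \<exists>W. W \<subseteq> E \<and> lin_subspace smulX W \<and> seq_closed_in E NE W
        \<and> dim_continuum smulX W \<and> x \<in> W \<and> W \<subseteq> Gw smulY E f \<Gamma> F \<union> {0})"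
proof (intro disjI2 ballI)
  fix x assume x: "x \<in> Gw smulY E f \<Gamma> F"
  show "\<exists>W. W \<subseteq> E \<and> lin_subspace smulX W \<and> seq_closed_in E NE W
        \<and> dim_continuum smulX W \<and> x \<in> W \<and> W \<subseteq> Gw smulY E f \<Gamma> F \<union> {0}"
  proof (cases "\<Gamma> = {}")
    case True
    then have Gw: "Gw smulY E f \<Gamma> F = E" by (simp add: Gw_def)
    \<comment> \<open>The set is now all of \<open>E\<close> and contains 0. Either \<open>x\<close>
      starts the independent sequence, or it is 0 and lies in every subspace.\<close>
    obtain u :: "nat \<Rightarrow> nat \<Rightarrow> 'x" where u: "\<And>n. u n \<in> E"
      "\<And>n. u n \<notin> module.span (seqscale smulX) (u ` {..<n})" "x = u 0 \<or> x = 0"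
      using inv_seq_space_independent_sequence[OF assms(3)] x Gw by metis
    obtain W where W: "W \<subseteq> E" "lin_subspace smulX W" "seq_closed_in E NE W" "dim_continuum smulX W"
      "range u \<subseteq> W"
      using inv_seq_space_dim_continuum_subspace[OF assms(3) u(1,2)] by metis
    have "x \<in> W" using u(3) W(2,5) by (auto simp: lin_subspace_def)
    then show ?thesis using W Gw by blast
  next
    case False
    interpret compatible_family smulX smulY \<Gamma> F NF f
      using assms(4-6) False by unfold_locales auto
    have "x \<in> E" "outside x" using x Gw_iff by auto
    from pointwise_continuum_spaceable[OF assms(1,3) this]
    obtain W where W: "W \<subseteq> E" "lin_subspace smulX W" "seq_closed_in E NE W" "dim_continuum smulX W"
      "x \<in> W" "\<forall>w\<in>W. w = 0 \<or> outside w"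
      by (elim exE conjE) (rule that, assumption+)
    have "W \<subseteq> Gw smulY E f \<Gamma> F \<union> {0}"
    proof
      fix w assume "w \<in> W"
      then show "w \<in> Gw smulY E f \<Gamma> F \<union> {0}" using W(1,6) Gw_iff by auto
    qed
    with W(1-5) show ?thesis by (intro exI[of _ W] conjI)
  qed
qed

end
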